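(* Fix $d\ge 2$. Let $D=(0,1)^d$ and $f\in L_2(D)$ with $f\ge c_f>0$ on $D$. Let $n\ge 1$, let $a=\sum_{Q\in\mathcal{P}_n}a_Q\chi_Q$ and $b=\sum_{Q\in\mathcal{P}_n}b_Q\chi_Q$ belong to $\mathcal{A}^n$, and let $u_a,u_b$ be the corresponding weak solutions on $D$ with right side $f$. Then for each $Q\in\mathcal{P}_n$, $$|a_Q-b_Q|\le C n^{\frac{d+2}{2}}\|\nabla u_a-\nabla u_b\|_{L_2(Q)},$$ where $C$ depends only on $c_f$ and $\Lambda$ (and the fixed dimension $d$). Therefore, $$\|a-b\|_{L_2(D)}\le Cn\|u_a-u_b\|_{H^1_0(D)}.$$
   Context: $0<\lambda<\Lambda$ are fixed constants. $\mathcal{P}_n$ is the partition of $D=(0,1)^d$ into $n^d$ disjoint cubes of side length $1/n$. $\mathcal{A}^n$ is the set of all piecewise constant diffusion coefficients $a=\sum_{Q\in\mathcal{P}_n}a_Q\chi_Q$ on $D$ with $a_Q\in[\lambda,\Lambda]$, where $\chi_Q$ is the characteristic function of $Q$. $H^1_0(D)$ is equipped with the norm $\|v\|_{H^1_0(D)}=\|\nabla v\|_{L_2(D)}$. $u_a\in H^1_0(D)$ is the unique weak solution of $-\mathrm{div}(a\nabla u_a)=f$ on $D$, $u_a=0$ on $\partial D$, i.e. $\int_D a\nabla u_a\cdot\nabla v=\int_D fv$ for all $v\in H^1_0(D)$. *)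

theory Defs
  imports "HOL-Analysis.Analysis"
begin

text \<open>Values outside \<open>S\<close> are irrelevant: \<^term>\<open>lebesgue_on S\<close> is Lebesgue measure restricted to \<open>S\<close>.
  Elements are functions, not equivalence classes.\<close>

definition L2_space :: "'n::euclidean_space set \<Rightarrow> ('n \<Rightarrow> 'b::real_normed_vector) set" where
  "L2_space S = {f \<in> borel_measurable (lebesgue_on S).
                   integrable (lebesgue_on S) (\<lambda>x. (norm (f x))\<^sup>2)}"

definition L2_norm :: "'n::euclidean_space set \<Rightarrow> ('n \<Rightarrow> 'b::real_normed_vector) \<Rightarrow> real" where
  "L2_norm S f = sqrt (LINT x|lebesgue_on S. (norm (f x))\<^sup>2)"

definition partial_deriv :: "'d::finite \<Rightarrow> (real^'d \<Rightarrow> real) \<Rightarrow> real^'d \<Rightarrow> real" where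
  "partial_deriv i f x = frechet_derivative f (at x) (axis i 1)"

primrec C_k :: "nat \<Rightarrow> (real^'d::finite \<Rightarrow> real) \<Rightarrow> bool" where
  "C_k 0 f \<longleftrightarrow> continuous_on UNIV f"
| "C_k (Suc k) f \<longleftrightarrow> (\<forall>x. f differentiable (at x)) \<and> (\<forall>i. C_k k (partial_deriv i f))"

text \<open>Smooth functions with compact support in \<open>D\<close> are identified with their extensions by zero.\<close>

definition test_functions :: "(real^'d::finite) set \<Rightarrow> (real^'d \<Rightarrow> real) set" where
  "test_functions D = {\<phi>. (\<forall>k. C_k k \<phi>) \<and> compact (closure {x. \<phi> x \<noteq> 0}) \<and>
                           closure {x. \<phi> x \<noteq> 0} \<subseteq> D}"

definition locally_integrable_on :: "(real^'d::finite \<Rightarrow> 'b::euclidean_space) \<Rightarrow> (real^'d) set \<Rightarrow> bool"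
    (infixr \<open>locally'_integrable'_on\<close> 46) where
  "f locally_integrable_on D \<longleftrightarrow> (\<forall>K. compact K \<and> K \<subseteq> D \<longrightarrow> f absolutely_integrable_on K)"

definition has_weak_gradient ::
    "(real^'d::finite) set \<Rightarrow> (real^'d \<Rightarrow> real) \<Rightarrow> (real^'d \<Rightarrow> real^'d) \<Rightarrow> bool" where
  "has_weak_gradient D u G \<longleftrightarrow>
     u locally_integrable_on D \<and> G locally_integrable_on D \<and>
     (\<forall>\<phi>\<in>test_functions D. \<forall>i.
        (LINT x|lebesgue_on D. u x * partial_deriv i \<phi> x) = - (LINT x|lebesgue_on D. G x $ i * \<phi> x))"

text \<open>For open \<open>D\<close>, weak gradients are unique up to null sets; the choice below fixes a representative
  (and is meaningful only if a weak gradient exists).\<close>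

definition weak_gradient :: "(real^'d::finite) set \<Rightarrow> (real^'d \<Rightarrow> real) \<Rightarrow> real^'d \<Rightarrow> real^'d" where
  "weak_gradient D u = (SOME G. has_weak_gradient D u G)"

definition H1 :: "(real^'d::finite) set \<Rightarrow> (real^'d \<Rightarrow> real) set" where
  "H1 D = {u \<in> L2_space D. \<exists>G\<in>L2_space D. has_weak_gradient D u G}"

definition H1_norm :: "(real^'d::finite) set \<Rightarrow> (real^'d \<Rightarrow> real) \<Rightarrow> real" where
  "H1_norm D u = sqrt ((L2_norm D u)\<^sup>2 + (L2_norm D (weak_gradient D u))\<^sup>2)"

definition H10 :: "(real^'d::finite) set \<Rightarrow> (real^'d \<Rightarrow> real) set" where
  "H10 D = {u \<in> H1 D. \<forall>\<epsilon>>0. \<exists>\<phi>\<in>test_functions D. H1_norm D (\<lambda>x. u x - \<phi> x) < \<epsilon>}"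

definition H10_norm :: "(real^'d::finite) set \<Rightarrow> (real^'d \<Rightarrow> real) \<Rightarrow> real" where
  "H10_norm D v = L2_norm D (weak_gradient D v)"

text \<open>Weak form of \<open>-div (a \<nabla>u) = f\<close> on \<open>D\<close>, \<open>u = 0\<close> on the boundary of \<open>D\<close>.\<close>

definition weak_solution ::
    "(real^'d::finite) set \<Rightarrow> (real^'d \<Rightarrow> real) \<Rightarrow> (real^'d \<Rightarrow> real) \<Rightarrow> (real^'d \<Rightarrow> real) \<Rightarrow> bool" where
  "weak_solution D f a u \<longleftrightarrow> u \<in> H10 D \<and>
     (\<forall>v\<in>H10 D. (LINT x|lebesgue_on D. a x * (weak_gradient D u x \<bullet> weak_gradient D v x)) =
                 (LINT x|lebesgue_on D. f x * v x))"

definition unit_cube :: "(real^'d::finite) set" where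
  "unit_cube = {x. \<forall>i. 0 < x $ i \<and> x $ i < 1}"

text \<open>The grid cubes are taken half-open and intersected with the open unit cube, so that they
  form a genuine partition of it.\<close>

definition grid_cube :: "nat \<Rightarrow> ('d::finite \<Rightarrow> nat) \<Rightarrow> (real^'d) set" where
  "grid_cube n k = {x \<in> unit_cube. \<forall>i. real (k i) / real n \<le> x $ i \<and> x $ i < (real (k i) + 1) / real n}"

definition grid :: "nat \<Rightarrow> (real^'d::finite) set set" where
  "grid n = grid_cube n ` {k. \<forall>i. k i < n}"

definition piecewise_const :: "nat \<Rightarrow> ((real^'d::finite) set \<Rightarrow> real) \<Rightarrow> real^'d \<Rightarrow> real" where
  "piecewise_const n \<alpha> x = (\<Sum>Q\<in>grid n. \<alpha> Q * indicator Q x)"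

definition diffusion_coeffs :: "real \<Rightarrow> real \<Rightarrow> nat \<Rightarrow> (real^'d::finite \<Rightarrow> real) set" where
  "diffusion_coeffs lam Lam n =
     {piecewise_const n \<alpha> | \<alpha>. \<forall>Q\<in>grid n. \<alpha> Q \<in> {lam..Lam}}"

end

theory Submission
  imports Defs
begin

text \<open>Test both weak formulations with a bump function \<open>\<phi>\<close> supported in \<open>Q\<close>. Both coefficients are
  constant there, so \<open>a\<^sub>Q X = F = b\<^sub>Q Y\<close>, where \<open>X\<close> and \<open>Y\<close> are the integrals over \<open>Q\<close> of \<open>\<nabla>u\<^sub>a \<bullet> \<nabla>\<phi>\<close> and
  \<open>\<nabla>u\<^sub>b \<bullet> \<nabla>\<phi>\<close> and \<open>F\<close> is that of \<open>f \<phi>\<close>. Hence \<open>F (b\<^sub>Q - a\<^sub>Q) = a\<^sub>Q b\<^sub>Q (X - Y)\<close>, and by Cauchy-Schwarz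
  \<open>F \<bar>a\<^sub>Q - b\<^sub>Q\<bar>\<close> is at most \<open>\<Lambda>\<^sup>2\<close> times the \<open>L\<^sub>2(Q)\<close> norms of \<open>\<nabla>u\<^sub>a - \<nabla>u\<^sub>b\<close> and \<open>\<nabla>\<phi>\<close>. If \<open>\<phi>\<close> is a fixed bump
  rescaled to side length \<open>1/n\<close>, then \<open>F\<close> is at least of order \<open>c\<^sub>f n\<^sup>-\<^sup>d\<close> and the norm of \<open>\<nabla>\<phi>\<close> is of order
  \<open>n\<^sup>1\<^sup>-\<^sup>d\<^sup>/\<^sup>2\<close>. Squaring, multiplying by the measure \<open>n\<^sup>-\<^sup>d\<close> of \<open>Q\<close> and summing over \<open>Q\<close> gives the global bound.\<close>

section \<open>Smooth bump functions\<close>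

lemma partial_derivI:
  assumes "(f has_derivative f') (at x)"
  shows "partial_deriv i f x = f' (axis i 1)"
  using frechet_derivative_at[OF assms] by (simp add: partial_deriv_def)

lemma has_derivative_frechet:
  assumes "f differentiable (at x)"
  shows "(f has_derivative frechet_derivative f (at x)) (at x)"
  using assms by (simp add: frechet_derivative_works)

lemma C_k_continuous_on:
  assumes "C_k k f"
  shows "continuous_on S f"
proof -
  have "continuous_on UNIV f"
    using assms by (cases k) (auto simp: continuous_on_eq_continuous_at differentiable_imp_continuous_within)
  then show ?thesis
    using continuous_on_subset by blast
qed

text \<open>Only the base case has content: \<open>C_k 1\<close> asks for differentiability, which
  implies the continuity asked for by \<open>C_k 0\<close>.\<close>

lemma C_k_SucD: "C_k (Suc k) f \<Longrightarrow> C_k k f"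
proof (induction k arbitrary: f)
  case 0
  then show ?case using C_k_continuous_on by fastforce
qed auto

lemma partial_deriv_const: "partial_deriv i (\<lambda>x. c) = (\<lambda>x. 0)"
  by (rule ext, subst partial_derivI[OF has_derivative_const]) simp

lemma C_k_const: "C_k k (\<lambda>x. c)"
  by (induction k arbitrary: c) (auto simp: partial_deriv_const)

lemma partial_deriv_add:
  assumes "f differentiable (at x)" "g differentiable (at x)"
  shows "partial_deriv i (\<lambda>x. f x + g x) x = partial_deriv i f x + partial_deriv i g x"
  by (subst partial_derivI[OF has_derivative_add[OF assms[THEN has_derivative_frechet]]])
    (simp add: partial_deriv_def)

lemma partial_deriv_mult:
  assumes "f differentiable (at x)" "g differentiable (at x)"
  shows "partial_deriv i (\<lambda>x. f x * g x) x = f x * partial_deriv i g x + partial_deriv i f x * g x"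
  by (subst partial_derivI[OF has_derivative_mult[OF assms[THEN has_derivative_frechet]]])
    (simp add: partial_deriv_def)

lemma C_k_add: "C_k k f \<Longrightarrow> C_k k g \<Longrightarrow> C_k k (\<lambda>x. f x + g x)"
proof (induction k arbitrary: f g)
  case 0
  then show ?case by (simp add: continuous_on_add)
next
  case (Suc k)
  then have "partial_deriv i (\<lambda>x. f x + g x) = (\<lambda>x. partial_deriv i f x + partial_deriv i g x)" for i
    by (intro ext partial_deriv_add) auto
  with Suc show ?case by simp
qed

lemma C_k_mult: "C_k k f \<Longrightarrow> C_k k g \<Longrightarrow> C_k k (\<lambda>x. f x * g x)"
proof (induction k arbitrary: f g)
  case 0
  then show ?case by (simp add: continuous_on_mult)
next
  case (Suc k)
  then have *: "partial_deriv i (\<lambda>x. f x * g x) =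
      (\<lambda>x. f x * partial_deriv i g x + partial_deriv i f x * g x)" for i
    by (intro ext partial_deriv_mult) auto
  \<comment> \<open>The product rule puts \<open>f\<close> and \<open>g\<close> themselves next to
    their partial derivatives, so the induction hypothesis needs them at order \<open>k\<close>
    too.\<close>
  from Suc.prems have "C_k k f" "C_k k g" by (auto intro!: C_k_SucD simp del: C_k.simps)
  with Suc show ?case by (simp add: * C_k_add)
qed

lemma C_k_prod: "finite I \<Longrightarrow> (\<And>i. i \<in> I \<Longrightarrow> C_k k (f i)) \<Longrightarrow> C_k k (\<lambda>x. \<Prod>i\<in>I. f i x)"
  by (induction I rule: finite_induct) (simp_all add: C_k_const C_k_mult)

text \<open>The polynomial factor makes the family closed under differentiation.\<close>

definition flat :: "real poly \<Rightarrow> real \<Rightarrow> real" where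
  "flat p t = (if t > 0 then poly p (1 / t) * exp (- (1 / t)) else 0)"

text \<open>Each monomial is beaten by the exponential. With s = 1/t this gives the limits at 0 of
  the functions \<open>flat p\<close>.\<close>

lemma poly_times_exp_minus_tendsto_0:
  "((\<lambda>s::real. poly p s * exp (- s)) \<longlongrightarrow> 0) at_top"
proof -
  have "((\<lambda>s. \<Sum>i\<le>degree p. coeff p i * (s ^ i / exp s)) \<longlongrightarrow> (\<Sum>i\<le>degree p. coeff p i * 0)) at_top"
    by (intro tendsto_sum tendsto_mult tendsto_const tendsto_power_div_exp_0)
  then show ?thesis
    by (simp add: poly_altdef sum_distrib_right exp_minus divide_inverse mult.assoc)
qed

lemma flat_tendsto_0: "(flat p \<longlongrightarrow> 0) (at_right 0)"
proof -
  have "((\<lambda>t::real. poly p (1 / t) * exp (- (1 / t))) \<longlongrightarrow> 0) (at_right 0)"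
    by (rule filterlim_compose[OF poly_times_exp_minus_tendsto_0])
      (simp add: filterlim_inverse_at_top_right flip: inverse_eq_divide)
  then show ?thesis
    by (rule Lim_transform_eventually)
      (auto simp: flat_def eventually_at_filter)
qed

text \<open>With s = 1/t one has ds/dt = -s^2, so differentiating p(s) exp(-s) in t yields s^2 (p(s)
  - p'(s)) exp(-s); \<open>[:0, 0, 1:]\<close> is the factor s^2.\<close>

lemma flat_has_real_derivative:
  "(flat p has_real_derivative flat ([:0, 0, 1:] * (p - pderiv p)) t) (at t)"
proof (cases t "0::real" rule: linorder_cases)
  case less
  have "((\<lambda>t. 0) has_real_derivative 0) (at t)" by simp
  then have "(flat p has_real_derivative 0) (at t)"
    by (rule has_field_derivative_transform_within_open[of _ _ _ "{..<0}"])
      (use less in \<open>auto simp: flat_def\<close>)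
  with less show ?thesis by (simp add: flat_def)
next
  case greater
  have "((\<lambda>t. poly p (1 / t) * exp (- (1 / t))) has_real_derivative
      flat ([:0, 0, 1:] * (p - pderiv p)) t) (at t)"
    using greater
    by (auto intro!: derivative_eq_intros DERIV_chain2[OF poly_DERIV]
        simp: flat_def field_simps power2_eq_square)
  then show ?thesis
    by (rule has_field_derivative_transform_within_open[of _ _ _ "{0<..}"])
      (use greater in \<open>auto simp: flat_def\<close>)
next
  case equal
  have "((\<lambda>y. (flat p y - flat p 0) / (y - 0)) \<longlongrightarrow> 0) (at 0)"
  proof (rule filterlim_split_at)
    show "((\<lambda>y. (flat p y - flat p 0) / (y - 0)) \<longlongrightarrow> 0) (at_left 0)"
      by (rule Lim_transform_eventually[OF tendsto_const])
        (auto simp: flat_def eventually_at_filter)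
    show "((\<lambda>y. (flat p y - flat p 0) / (y - 0)) \<longlongrightarrow> 0) (at_right 0)"
      \<comment> \<open>For y > 0, dividing by y multiplies by s = 1/y, so the difference quotient
        is again of the form \<open>flat\<close>, with polynomial s p(s).\<close>
      by (rule Lim_transform_eventually[OF flat_tendsto_0[of "[:0, 1:] * p"]])
        (auto simp: flat_def eventually_at_filter)
  qed
  with equal show ?thesis
    by (simp add: has_field_derivative_iff flat_def)
qed

text \<open>The factor \<open>c\<close> is part of the claim so that the induction closes: a partial
  derivative changes \<open>p\<close> and multiplies \<open>c\<close> by \<open>s\<close>, or by 0
  in the other directions.\<close>

lemma C_k_flat: "C_k k (\<lambda>x. c * flat p (s * x $ i + t))"
proof (induction k arbitrary: c p)
  case 0
  have "continuous_on UNIV (flat p)"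
    using flat_has_real_derivative DERIV_isCont by (blast intro: continuous_at_imp_continuous_on)
  then have "continuous_on UNIV (\<lambda>x. flat p (s * x $ i + t))"
    by (rule continuous_on_compose2) (auto intro!: continuous_intros)
  then show ?case by (auto intro!: continuous_intros)
next
  case (Suc k)
  let ?q = "[:0, 0, 1:] * (p - pderiv p)"
  have "((\<lambda>x. flat p (s * x $ i + t)) has_derivative
      (\<lambda>h. flat ?q (s * x $ i + t) * (s * h $ i))) (at x)" for x :: "real^'a"
    by (rule has_derivative_compose[OF _ flat_has_real_derivative[unfolded has_field_derivative_def],
          of "\<lambda>x. s * x $ i + t"])
      (auto intro!: derivative_eq_intros bounded_linear.has_derivative[OF bounded_linear_vec_nth])
  then have d: "((\<lambda>x. c * flat p (s * x $ i + t)) has_derivative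
      (\<lambda>h. c * (flat ?q (s * x $ i + t) * (s * h $ i)))) (at x)" for x :: "real^'a"
    by (rule has_derivative_mult_right)
  have "partial_deriv j (\<lambda>x. c * flat p (s * x $ i + t)) =
      (\<lambda>x. (if i = j then c * s else 0) * flat ?q (s * x $ i + t))" for j
    by (rule ext, subst partial_derivI[OF d]) (auto simp: axis_def)
  moreover have "(\<lambda>x. c * flat p (s * x $ i + t)) differentiable at x" for x :: "real^'a"
    using d by (auto simp: differentiable_def)
  ultimately show ?case using Suc.IH by simp
qed

lemma flat_1_bounds: "0 \<le> flat 1 t" "flat 1 t \<le> 1" 
  by (auto simp: flat_def)

lemma flat_1_pos_iff: "flat 1 t > 0 \<longleftrightarrow> t > 0" "flat 1 t = 0 \<longleftrightarrow> t \<le> 0" 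
  by (auto simp: flat_def)

text \<open>The steepness \<open>m\<close> serves two purposes: letting it tend to infinity
  approximates the indicator of the box, and taking it equal to n makes the bumps on the grid cubes
  rescaled copies of one another.\<close>

definition bump :: "real \<Rightarrow> real^'d::finite \<Rightarrow> real^'d \<Rightarrow> real^'d \<Rightarrow> real" where
  "bump m l r x = (\<Prod>i\<in>UNIV. flat 1 (m * (x $ i - l $ i)) * flat 1 (m * (r $ i - x $ i)))"

lemma C_k_bump: "C_k k (bump m l r)"
proof -
  have 1: "C_k k (\<lambda>x::real^'a. flat 1 (m * (x $ i - l $ i)))" for i
    using C_k_flat[of k 1 1 m i "- m * l $ i"] by (simp add: algebra_simps)
  have 2: "C_k k (\<lambda>x::real^'a. flat 1 (m * (r $ i - x $ i)))" for i
    using C_k_flat[of k 1 1 "- m" i "m * r $ i"] by (simp add: algebra_simps)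
  show ?thesis
    unfolding bump_def[abs_def] by (intro C_k_prod C_k_mult 1 2) simp
qed

lemma bump_bounds: "0 \<le> bump m l r x" "bump m l r x \<le> 1"
  unfolding bump_def by (auto intro!: prod_nonneg prod_le_1 mult_le_one simp: flat_1_bounds)

lemma bump_nonzero_iff:
  assumes "m > 0"
  shows "bump m l r x \<noteq> 0 \<longleftrightarrow> x \<in> box l r"
  using assms by (auto simp: bump_def flat_1_pos_iff mem_box_cart not_le zero_less_mult_iff)

lemma bump_in_test_functions:
  assumes "m > 0" "cbox l r \<subseteq> D"
  shows "bump m l r \<in> test_functions D"
proof -
  have "closure {x. bump m l r x \<noteq> 0} \<subseteq> cbox l r"
    using assms by (intro closure_minimal) (auto simp: bump_nonzero_iff box_subset_cbox[THEN subsetD])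
  moreover from this have "compact (closure {x. bump m l r x \<noteq> 0})"
    by (meson bounded_cbox bounded_subset compact_closure closure_subset order_trans)
  ultimately show ?thesis
    using assms by (auto simp: test_functions_def C_k_bump)
qed

section \<open>Partial integration\<close>

lemma test_functions_C_k: "\<phi> \<in> test_functions D \<Longrightarrow> C_k k \<phi>"
  by (simp add: test_functions_def)

lemma C_k_1_differentiable: "C_k 1 \<phi> \<Longrightarrow> \<phi> differentiable (at x)"
  by simp

lemma C_k_1_partial_deriv_continuous: "C_k 1 \<phi> \<Longrightarrow> continuous_on S (partial_deriv i \<phi>)"
  by (auto intro: continuous_on_subset)

lemma partial_deriv_eq_0_outside:
  assumes "closed K" "\<And>y. y \<notin> K \<Longrightarrow> \<phi> y = 0" "x \<notin> K"
  shows "partial_deriv i \<phi> x = 0"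
proof -
  have "(\<phi> has_derivative (\<lambda>h. 0)) (at x)"
    by (rule has_derivative_transform_within_open[of "\<lambda>x. 0" _ _ _ "- K"])
      (use assms in auto)
  then show ?thesis by (simp add: partial_derivI)
qed

lemma test_functions_supportE:
  assumes "\<phi> \<in> test_functions D"
  obtains K where "compact K" "K \<subseteq> D" "\<And>x. x \<notin> K \<Longrightarrow> \<phi> x = 0"
    "\<And>x i. x \<notin> K \<Longrightarrow> partial_deriv i \<phi> x = 0"
proof
  let ?K = "closure {x. \<phi> x \<noteq> 0}"
  show "compact ?K" "?K \<subseteq> D" using assms unfolding test_functions_def by blast+
  show 0: "\<phi> x = 0" if "x \<notin> ?K" for x using that closure_subset[of "{x. \<phi> x \<noteq> 0}"] by auto
  show "partial_deriv i \<phi> x = 0" if "x \<notin> ?K" for x i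
    using partial_deriv_eq_0_outside[OF closed_closure 0 that] .
qed

lemma continuous_compact_support_bounded:
  fixes g :: "'a::euclidean_space \<Rightarrow> real"
  assumes "continuous_on UNIV g" "compact K" "\<And>x. x \<notin> K \<Longrightarrow> g x = 0"
  obtains B where "\<And>x. \<bar>g x\<bar> \<le> B" "B > 0"
proof -
  have "bounded (g ` K)"
    by (intro compact_imp_bounded compact_continuous_image assms(2) continuous_on_subset[OF assms(1)]) simp
  then obtain B where "B > 0" "\<And>x. x \<in> K \<Longrightarrow> \<bar>g x\<bar> \<le> B"
    by (auto simp: bounded_pos)
  then have "\<bar>g x\<bar> \<le> B" for x
    using assms(3) by (cases "x \<in> K") auto
  with \<open>B > 0\<close> that show thesis by blast
qed

lemma continuous_imp_borel_measurable_lebesgue: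
  fixes g :: "'a::euclidean_space \<Rightarrow> 'b::euclidean_space"
  assumes "continuous_on UNIV g"
  shows "g \<in> borel_measurable lebesgue"
  using borel_measurable_continuous_onI[OF assms] by (simp add: measurable_completion)

text \<open>The product is dominated by a constant multiple of \<bar>u\<bar> on \<open>K\<close>.
  This ensures that the integrals in \<open>has_weak_gradient\<close> exist, so that they may be
  split.\<close>

lemma integrable_mult_compact_support:
  fixes u g :: "real^'d::finite \<Rightarrow> real"
  assumes "u locally_integrable_on D" "continuous_on UNIV g"
    "compact K" "K \<subseteq> D" "\<And>x. x \<notin> K \<Longrightarrow> g x = 0"
  shows "integrable lebesgue (\<lambda>x. u x * g x)"
proof -
  obtain B where B: "\<And>x. \<bar>g x\<bar> \<le> B" "B > 0"
    using continuous_compact_support_bounded assms(2,3,5) by metis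
  have i: "integrable lebesgue (\<lambda>x. indicator K x *\<^sub>R u x)"
    using assms(1,3,4) by (simp add: locally_integrable_on_def set_integrable_def)
  have "integrable lebesgue (\<lambda>x. (indicator K x *\<^sub>R u x) * g x)"
  proof (rule Bochner_Integration.integrable_bound[OF integrable_mult_left[OF i, of B]])
    show "(\<lambda>x. (indicator K x *\<^sub>R u x) * g x) \<in> borel_measurable lebesgue"
      using borel_measurable_integrable[OF i] continuous_imp_borel_measurable_lebesgue[OF assms(2)]
      by (rule borel_measurable_times)
    show "AE x in lebesgue. norm ((indicator K x *\<^sub>R u x) * g x) \<le> norm (indicator K x *\<^sub>R u x * B)"
      using B by (intro AE_I2) (auto simp: abs_mult intro!: mult_left_mono)
  qed
  also have "(\<lambda>x. (indicator K x *\<^sub>R u x) * g x) = (\<lambda>x. u x * g x)"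
    using assms(5) by (intro ext) (auto simp: indicator_def)
  finally show ?thesis .
qed

lemma integral_lebesgue_on_eq:
  fixes h :: "'a::euclidean_space \<Rightarrow> 'b::{banach,second_countable_topology}"
  assumes "D \<in> sets lebesgue" "\<And>x. x \<notin> D \<Longrightarrow> h x = 0"
  shows "integral\<^sup>L (lebesgue_on D) h = integral\<^sup>L lebesgue h"
    and "integrable (lebesgue_on D) h \<longleftrightarrow> integrable lebesgue h"
proof -
  have "(\<lambda>x. indicator D x *\<^sub>R h x) = h"
    using assms(2) by (auto simp: indicator_def)
  with assms(1) show "integral\<^sup>L (lebesgue_on D) h = integral\<^sup>L lebesgue h"
    "integrable (lebesgue_on D) h \<longleftrightarrow> integrable lebesgue h"
    by (simp_all add: integral_restrict_space integrable_restrict_space)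
qed

lemma continuous_locally_integrable_on:
  fixes g :: "real^'d::finite \<Rightarrow> 'b::euclidean_space"
  assumes "continuous_on UNIV g"
  shows "g locally_integrable_on D"
  unfolding locally_integrable_on_def
proof (intro allI impI, elim conjE)
  fix K :: "(real^'d) set" assume "compact K"
  then obtain a b where "K \<subseteq> cbox a b"
    using bounded_subset_cbox_symmetric compact_imp_bounded by metis
  moreover have "g absolutely_integrable_on cbox a b"
    using assms by (intro absolutely_integrable_continuous) (rule continuous_on_subset, auto)
  ultimately show "g absolutely_integrable_on K"
    using \<open>compact K\<close> by (meson set_integrable_subset lmeasurable_compact fmeasurableD)
qed

lemma has_real_derivative_along_axis:
  assumes "f differentiable (at (x + t *\<^sub>R axis i 1))"
  shows "((\<lambda>t. f (x + t *\<^sub>R axis i 1)) has_real_derivative partial_deriv i f (x + t *\<^sub>R axis i 1)) (at t)"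
proof -
  let ?f' = "frechet_derivative f (at (x + t *\<^sub>R axis i 1))"
  have "((\<lambda>t. f (x + t *\<^sub>R axis i 1)) has_derivative (\<lambda>h. ?f' (h *\<^sub>R axis i 1))) (at t)"
    by (rule has_derivative_compose[where f = "\<lambda>t. x + t *\<^sub>R axis i 1",
          OF _ has_derivative_frechet[OF assms]])
      (auto intro!: derivative_eq_intros)
  moreover have "?f' (h *\<^sub>R axis i 1) = partial_deriv i f (x + t *\<^sub>R axis i 1) * h" for h
    using linear_frechet_derivative[OF assms] by (simp add: linear_cmul partial_deriv_def)
  ultimately show ?thesis
    by (simp add: has_field_derivative_def)
qed

lemma integral_translation_lborel:
  fixes g :: "'a::euclidean_space \<Rightarrow> real"
  assumes "g \<in> borel_measurable borel"
  shows "(LINT x|lborel. g (x + c)) = integral\<^sup>L lborel g"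
proof -
  have "integral\<^sup>L lborel g = integral\<^sup>L (distr lborel borel ((+) c)) g"
    by (simp add: lborel_distr_plus)
  also have "\<dots> = (LINT x|lborel. g (c + x))"
    using assms by (subst integral_distr) auto
  finally show ?thesis by (simp add: add.commute)
qed

text \<open>The difference quotients of a compactly supported function have integral zero by translation
  invariance, and they converge dominatedly to the partial derivative.\<close>

lemma integral_partial_deriv_eq_0:
  fixes g :: "real^'d::finite \<Rightarrow> real"
  assumes g: "C_k 1 g" and K: "compact K" "\<And>x. x \<notin> K \<Longrightarrow> g x = 0"
  shows "integral\<^sup>L lebesgue (partial_deriv i g) = 0"
proof -
  define e :: "real^'d" where "e = axis i 1"
  define h :: "nat \<Rightarrow> real" where "h n = 1 / real (Suc n)" for n
  have h: "0 < h n" "h n \<le> 1" "h n \<noteq> 0" for n by (auto simp: h_def)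
  have h0: "h \<longlonglongrightarrow> 0"
    unfolding h_def using LIMSEQ_inverse_real_of_nat by (simp add: inverse_eq_divide)
  have D: "((\<lambda>t. g (x + t *\<^sub>R e)) has_real_derivative partial_deriv i g (x + t *\<^sub>R e)) (at t)" for x t
    unfolding e_def by (rule has_real_derivative_along_axis) (use g in simp)
  have cg: "continuous_on UNIV g" using C_k_continuous_on[OF g] .
  have cd: "continuous_on UNIV (partial_deriv i g)" using C_k_1_partial_deriv_continuous[OF g] .
  have mg: "g \<in> borel_measurable borel" using borel_measurable_continuous_onI[OF cg] .
  have md: "partial_deriv i g \<in> borel_measurable borel" using borel_measurable_continuous_onI[OF cd] .
  obtain B where B: "\<And>x. \<bar>partial_deriv i g x\<bar> \<le> B" "B > 0"
    using continuous_compact_support_bounded[OF cd K(1)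
        partial_deriv_eq_0_outside[OF compact_imp_closed[OF K(1)] K(2)]] by metis
  define q where "q n x = (g (x + h n *\<^sub>R e) - g x) / h n" for n x
  obtain R where R: "\<And>x. x \<in> K \<Longrightarrow> norm x \<le> R"
    using compact_imp_bounded[OF K(1)] by (auto simp: bounded_iff)
  \<comment> \<open>The shifts have length at most 1, so one ball contains the supports of all
    difference quotients; its indicator times \<open>B\<close> is the dominating function.\<close>
  have q0: "q n x = 0" if "x \<notin> cball 0 (R + 1)" for n x
  proof -
    have "norm (h n *\<^sub>R e) \<le> 1" using h[of n] by (simp add: e_def)
    moreover have "norm x > R + 1" using that by (simp add: dist_norm)
    ultimately have "norm (x + h n *\<^sub>R e) > R" "norm x > R"
      using norm_triangle_ineq[of x "h n *\<^sub>R e"] norm_diff_ineq[of x "h n *\<^sub>R e"] by linarith+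
    then have "x + h n *\<^sub>R e \<notin> K" "x \<notin> K" using R by fastforce+
    then show ?thesis using K(2) by (simp add: q_def)
  qed
  \<comment> \<open>By the mean value theorem along the axis, a difference quotient is a value of
    the partial derivative.\<close>
  have qB: "\<bar>q n x\<bar> \<le> B" for n x
  proof -
    obtain z where "g (x + h n *\<^sub>R e) - g (x + 0 *\<^sub>R e) = (h n - 0) * partial_deriv i g (x + z *\<^sub>R e)"
      using MVT2[OF h(1) D] by metis
    then have "q n x = partial_deriv i g (x + z *\<^sub>R e)"
      using h[of n] by (simp add: q_def)
    with B show ?thesis by simp
  qed
  have mq: "q n \<in> borel_measurable borel" for n
    using mg unfolding q_def[abs_def] by measurable
  have ig: "integrable lborel g"
    using integrable_mult_compact_support[OF continuous_locally_integrable_on cg K(1) subset_UNIV K(2), of "\<lambda>x. 1"]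
    by (simp add: integrable_completion mg)
  have int_q: "integral\<^sup>L lborel (q n) = 0" for n
  proof -
    have "integrable lborel (\<lambda>x. g (x + h n *\<^sub>R e))"
      using ig mg integrable_distr_eq[of "(+) (h n *\<^sub>R e)" lborel borel g]
      by (simp add: lborel_distr_plus add.commute)
    then show ?thesis
      using ig mg by (simp add: q_def[abs_def] integral_translation_lborel)
  qed
  have "(\<lambda>n. integral\<^sup>L lborel (q n)) \<longlonglongrightarrow> integral\<^sup>L lborel (partial_deriv i g)"
  proof (rule integral_dominated_convergence)
    show "integrable lborel (\<lambda>x. indicator (cball 0 (R + 1)) x *\<^sub>R B)"
      by (intro integrable_scaleR_left integrable_real_indicator) (use emeasure_bounded_finite[OF bounded_cball, of 0 "R + 1"] in auto)
    show "AE x in lborel. norm (q n x) \<le> indicator (cball 0 (R + 1)) x *\<^sub>R B" for n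
      using q0 qB by (intro AE_I2) (auto simp: indicator_def)
    show "AE x in lborel. (\<lambda>n. q n x) \<longlonglongrightarrow> partial_deriv i g x"
    proof (rule AE_I2)
      fix x
      have "((\<lambda>t. (g (x + t *\<^sub>R e) - g x) / t) \<longlongrightarrow> partial_deriv i g x) (at 0)"
        using D[of x 0] by (simp add: has_field_derivative_iff)
      moreover have "filterlim h (at 0) sequentially"
        using h0 h by (simp add: filterlim_at)
      ultimately show "(\<lambda>n. q n x) \<longlonglongrightarrow> partial_deriv i g x"
        unfolding q_def by (rule filterlim_compose)
    qed
  qed (use mq md in auto)
  with int_q have "integral\<^sup>L lborel (partial_deriv i g) = 0"
    by (simp add: LIMSEQ_const_iff)
  then show ?thesis
    using md by (simp add: integral_completion)
qed

abbreviation gradient :: "(real^'d::finite \<Rightarrow> real) \<Rightarrow> real^'d \<Rightarrow> real^'d" where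
  "gradient \<phi> x \<equiv> \<chi> i. partial_deriv i \<phi> x"

text \<open>The product of \<phi> with a test function \<psi> has compact support, so its partial
  derivatives integrate to zero; the product rule splits that integral.\<close>

lemma has_weak_gradient_C_k:
  assumes D: "D \<in> sets lebesgue" and \<phi>: "C_k 1 \<phi>"
  shows "has_weak_gradient D \<phi> (gradient \<phi>)"
  unfolding has_weak_gradient_def
proof (intro conjI ballI allI)
  show "\<phi> locally_integrable_on D"
    by (intro continuous_locally_integrable_on C_k_continuous_on[OF \<phi>])
  show "gradient \<phi> locally_integrable_on D"
    by (intro continuous_locally_integrable_on continuous_on_vec_lambda
        C_k_1_partial_deriv_continuous[OF \<phi>])
  fix \<psi> :: "real^'a \<Rightarrow> real" and i assume \<psi>: "\<psi> \<in> test_functions D"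
  obtain K where K: "compact K" "K \<subseteq> D" "\<And>x. x \<notin> K \<Longrightarrow> \<psi> x = 0"
    "\<And>x. x \<notin> K \<Longrightarrow> partial_deriv i \<psi> x = 0"
    using test_functions_supportE[OF \<psi>] by metis
  have C: "C_k 1 \<psi>" using test_functions_C_k[OF \<psi>] .
  have 1: "integrable lebesgue (\<lambda>x. \<phi> x * partial_deriv i \<psi> x)"
    by (rule integrable_mult_compact_support[OF continuous_locally_integrable_on _ K(1,2,4)])
      (use C_k_continuous_on[OF \<phi>] C_k_1_partial_deriv_continuous[OF C] in auto)
  have 2: "integrable lebesgue (\<lambda>x. partial_deriv i \<phi> x * \<psi> x)"
    by (rule integrable_mult_compact_support[OF continuous_locally_integrable_on _ K(1,2,3)])
      (use C_k_continuous_on[OF C] C_k_1_partial_deriv_continuous[OF \<phi>] in auto)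
  have "(LINT x|lebesgue. \<phi> x * partial_deriv i \<psi> x) + (LINT x|lebesgue. partial_deriv i \<phi> x * \<psi> x)
      = (LINT x|lebesgue. partial_deriv i (\<lambda>x. \<phi> x * \<psi> x) x)"
    using \<phi> C by (simp add: partial_deriv_mult Bochner_Integration.integral_add[OF 1 2])
  also have "\<dots> = 0"
    by (rule integral_partial_deriv_eq_0[OF C_k_mult[OF \<phi> C] K(1)]) (simp add: K(3))
  finally show "(LINT x|lebesgue_on D. \<phi> x * partial_deriv i \<psi> x) =
      - (LINT x|lebesgue_on D. gradient \<phi> x $ i * \<psi> x)"
    using K(2-4) by (subst (1 2) integral_lebesgue_on_eq[OF D]) auto
qed

section \<open>Uniqueness of weak gradients\<close>

lemma flat_1_tendsto_1:
  assumes "c > 0"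
  shows "(\<lambda>n. flat 1 (real (Suc n) * c)) \<longlonglongrightarrow> 1"
proof -
  have "(\<lambda>n. exp (- (inverse (real (Suc n)) / c))) \<longlonglongrightarrow> exp (- (0 / c))"
    using assms by (intro tendsto_intros LIMSEQ_inverse_real_of_nat) auto
  moreover have "flat 1 (real (Suc n) * c) = exp (- (inverse (real (Suc n)) / c))" for n
    using assms by (simp add: flat_def field_simps del: of_nat_Suc)
  ultimately show ?thesis by simp
qed

lemma bump_tendsto_indicator:
  "(\<lambda>n. bump (real (Suc n)) l r x) \<longlonglongrightarrow> indicator (box l r) x"
proof (cases "x \<in> box l r")
  case True
  have "(\<lambda>n. bump (real (Suc n)) l r x) \<longlonglongrightarrow> (\<Prod>i\<in>(UNIV :: 'a set). 1 * 1)"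
    unfolding bump_def using True
    by (intro tendsto_prod tendsto_mult flat_1_tendsto_1) (auto simp: mem_box_cart)
  with True show ?thesis by simp
next
  case False
  then have "bump (real (Suc n)) l r x = 0" for n
    using bump_nonzero_iff[of "real (Suc n)"] by auto
  with False show ?thesis by simp
qed

text \<open>Test with bumps of growing steepness, which converge to the indicator of the open box
  and are dominated by 1. The boundary of the box is a null set.\<close>

lemma integral_box_eq_0:
  fixes g :: "real^'d::finite \<Rightarrow> real"
  assumes D: "D \<in> sets lebesgue" and g: "g locally_integrable_on D"
    and zero: "\<And>\<phi>. \<phi> \<in> test_functions D \<Longrightarrow> (LINT x|lebesgue_on D. g x * \<phi> x) = 0"
    and sub: "cbox l r \<subseteq> D"
  shows "integral (cbox l r) g = 0"
proof -
  have i: "integrable lebesgue (\<lambda>x. indicator (cbox l r) x *\<^sub>R g x)"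
    using g sub by (simp add: locally_integrable_on_def set_integrable_def)
  then have mi: "(\<lambda>x. indicator (cbox l r) x *\<^sub>R g x) \<in> borel_measurable lebesgue"
    by (rule borel_measurable_integrable)
  define \<beta> :: "nat \<Rightarrow> real^'d \<Rightarrow> real" where "\<beta> n = bump (real (Suc n)) l r" for n
  have \<beta>0: "\<beta> n x = 0" if "x \<notin> box l r" for n x
    using bump_nonzero_iff[of "real (Suc n)" l r x] that by (auto simp: \<beta>_def)
  have \<beta>0': "\<beta> n x = 0" if "x \<notin> cbox l r" for n x
    using \<beta>0 that box_subset_cbox by blast
  have \<beta>m: "\<beta> n \<in> borel_measurable lebesgue" for n
    unfolding \<beta>_def by (intro continuous_imp_borel_measurable_lebesgue C_k_continuous_on[OF C_k_bump])
  let ?h = "\<lambda>n x. (indicator (cbox l r) x *\<^sub>R g x) * \<beta> n x"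
  have "integral\<^sup>L lebesgue (?h n) = 0" for n
  proof -
    have "\<beta> n \<in> test_functions D"
      unfolding \<beta>_def by (intro bump_in_test_functions sub) simp
    then have "(LINT x|lebesgue_on D. g x * \<beta> n x) = 0" by (rule zero)
    moreover have "(LINT x|lebesgue_on D. g x * \<beta> n x) = (LINT x|lebesgue. g x * \<beta> n x)"
      using sub \<beta>0' by (intro integral_lebesgue_on_eq[OF D]) auto
    moreover have "(\<lambda>x. g x * \<beta> n x) = ?h n"
      using \<beta>0' by (intro ext) (auto simp: indicator_def)
    ultimately show ?thesis by simp
  qed
  moreover have "(\<lambda>n. integral\<^sup>L lebesgue (?h n)) \<longlonglongrightarrow>
      (LINT x|lebesgue. (indicator (cbox l r) x *\<^sub>R g x) * indicator (box l r) x)"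
  proof (rule integral_dominated_convergence)
    show "integrable lebesgue (\<lambda>x. norm (indicator (cbox l r) x *\<^sub>R g x))"
      using i by (rule integrable_norm)
    show "AE x in lebesgue. (\<lambda>n. ?h n x) \<longlonglongrightarrow> (indicator (cbox l r) x *\<^sub>R g x) * indicator (box l r) x"
      unfolding \<beta>_def by (intro AE_I2 tendsto_mult tendsto_const bump_tendsto_indicator)
    show "AE x in lebesgue. norm (?h n x) \<le> norm (indicator (cbox l r) x *\<^sub>R g x)" for n
      unfolding \<beta>_def norm_mult using bump_bounds[of "real (Suc n)" l r]
      by (intro AE_I2 mult_left_le) auto
    show "?h n \<in> borel_measurable lebesgue" for n
      by (intro borel_measurable_times mi \<beta>m)
    show "(\<lambda>x. (indicator (cbox l r) x *\<^sub>R g x) * indicator (box l r) x) \<in> borel_measurable lebesgue"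
      by (intro borel_measurable_times mi borel_measurable_indicator) auto
  qed
  ultimately have 0: "(LINT x|lebesgue. (indicator (cbox l r) x *\<^sub>R g x) * indicator (box l r) x) = 0"
    by (simp add: LIMSEQ_const_iff)
  have "(\<lambda>x. (indicator (cbox l r) x *\<^sub>R g x) * indicator (box l r) x) = (\<lambda>x. indicator (box l r) x *\<^sub>R g x)"
    using box_subset_cbox[of l r] by (intro ext) (auto simp: indicator_def)
  with 0 have "set_lebesgue_integral lebesgue (box l r) g = 0"
    by (simp add: set_lebesgue_integral_def)
  moreover have "set_integrable lebesgue (box l r) g"
    by (rule set_integrable_subset[OF i[folded set_integrable_def] _ box_subset_cbox]) simp
  ultimately show ?thesis
    by (simp add: set_lebesgue_integral_eq_integral integral_open_interval)
qed

text \<open>All averages of \<open>g\<close> over small boxes vanish, so \<open>g\<close> vanishes at its Lebesgue points.\<close>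

lemma fundamental_lemma_calculus_of_variations:
  fixes g :: "real^'d::finite \<Rightarrow> real"
  assumes D: "open D" and g: "g locally_integrable_on D"
    and zero: "\<And>\<phi>. \<phi> \<in> test_functions D \<Longrightarrow> (LINT x|lebesgue_on D. g x * \<phi> x) = 0"
  shows "AE x in lebesgue_on D. g x = 0"
proof -
  have Dm: "D \<in> sets lebesgue" using D by auto
  have box: "negligible {x \<in> cbox a b. g x \<noteq> 0}" if ab: "cbox a b \<subseteq> D" for a b
  proof -
    define f where "f x = indicator (cbox a b) x *\<^sub>R g x" for x
    have "integrable lebesgue f"
      using g ab by (simp add: f_def[abs_def] locally_integrable_on_def set_integrable_def)
    then have "f integrable_on UNIV"
      using set_lebesgue_integral_eq_integral(1)[of UNIV f] by (simp add: set_integrable_def)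
    then have "\<And>c d. f integrable_on cbox c d"
      by (rule integrable_on_subcbox) simp
    \<comment> \<open>This is the Lebesgue differentiation theorem for cubes having \<open>x\<close>
      as their lower corner.\<close>
    then obtain N where N: "negligible N" "\<And>x e. \<lbrakk>x \<notin> N; 0 < e\<rbrakk> \<Longrightarrow>
        \<exists>d>0. \<forall>h. 0 < h \<and> h < d \<longrightarrow> norm (integral (cbox x (x + h *\<^sub>R One)) f /\<^sub>R h ^ DIM(real^'d) - f x) < e"
      using integrable_ccontinuous_explicit by blast
    have "x \<in> N" if x: "x \<in> box a b" "g x \<noteq> 0" for x
    proof (rule ccontr)
      assume "x \<notin> N"
      have fx: "f x = g x" using x box_subset_cbox[of a b] by (auto simp: f_def)
      \<comment> \<open>The average of \<open>f\<close> will be 0 and \<open>f x = g x\<close>, so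
        the tolerance \<bar>g x\<bar> gives the contradiction \<bar>g x\<bar> < \<bar>g
        x\<bar>.\<close>
      obtain d where d: "d > 0"
        "\<And>h. 0 < h \<Longrightarrow> h < d \<Longrightarrow> norm (integral (cbox x (x + h *\<^sub>R One)) f /\<^sub>R h ^ DIM(real^'d) - f x) < \<bar>g x\<bar>"
        using N(2)[OF \<open>x \<notin> N\<close>, of "\<bar>g x\<bar>"] x by auto
      obtain \<epsilon> where \<epsilon>: "\<epsilon> > 0" "cball x \<epsilon> \<subseteq> box a b"
        using x open_box open_contains_cball by blast
      \<comment> \<open>The first bound keeps \<open>h\<close> below \<open>d\<close>, the second
        keeps the far corner of the cube within \<epsilon> of \<open>x\<close>.\<close>
      define h where "h = min (d / 2) (\<epsilon> / (1 + norm (One :: real^'d)))"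
      have pos: "1 + norm (One :: real^'d) > 0" using norm_ge_zero[of "One :: real^'d"] by linarith
      have h: "0 < h" "h < d" using d \<epsilon> pos by (auto simp: h_def)
      have "h * norm (One :: real^'d) \<le> h * (1 + norm (One :: real^'d))" using h by simp
      also have "\<dots> \<le> (\<epsilon> / (1 + norm (One :: real^'d))) * (1 + norm (One :: real^'d))"
        using pos by (intro mult_right_mono) (auto simp: h_def)
      also have "\<dots> = \<epsilon>" using pos by simp
      finally have "dist x (x + h *\<^sub>R One) \<le> \<epsilon>"
        using h by (simp add: dist_norm)
      then have "x \<in> box a b" "x + h *\<^sub>R One \<in> box a b" using \<epsilon> by auto
      then have sub: "cbox x (x + h *\<^sub>R One) \<subseteq> cbox a b"
        by (auto simp: mem_box) (meson order_trans less_imp_le)+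
      then have "integral (cbox x (x + h *\<^sub>R One)) f = integral (cbox x (x + h *\<^sub>R One)) g"
        by (intro Henstock_Kurzweil_Integration.integral_cong) (auto simp: f_def)
      also have "\<dots> = 0"
        using sub ab by (intro integral_box_eq_0[OF Dm g zero]) auto
      finally show False using d(2)[OF h] fx by simp
    qed
    then have "{x \<in> cbox a b. g x \<noteq> 0} \<subseteq> N \<union> (cbox a b - box a b)" by auto
    moreover have "negligible (N \<union> (cbox a b - box a b))"
      using N(1) negligible_frontier_interval by (rule negligible_Un)
    ultimately show ?thesis by (rule negligible_subset[rotated])
  qed
  \<comment> \<open>Countably many closed boxes exhaust \<open>D\<close>, so the exceptional null
    sets of the boxes add up to a null set.\<close>
  obtain \<D> where \<D>: "countable \<D>" "\<D> \<subseteq> Pow D" "\<And>X. X \<in> \<D> \<Longrightarrow> \<exists>a b. X = cbox a b" "\<Union>\<D> = D"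
    using open_countable_Union_open_cbox[OF D] by metis
  have "negligible (\<Union>X\<in>\<D>. {x \<in> X. g x \<noteq> 0})"
  proof (rule negligible_countable_Union)
    show "countable ((\<lambda>X. {x \<in> X. g x \<noteq> 0}) ` \<D>)" using \<D>(1) by simp
    fix Y assume "Y \<in> (\<lambda>X. {x \<in> X. g x \<noteq> 0}) ` \<D>"
    then obtain X where X: "X \<in> \<D>" "Y = {x \<in> X. g x \<noteq> 0}" by blast
    then obtain a b where "X = cbox a b" "X \<subseteq> D" using \<D>(2,3) by blast
    with X(2) show "negligible Y" using box by simp
  qed
  moreover have "(\<Union>X\<in>\<D>. {x \<in> X. g x \<noteq> 0}) = {x \<in> D. g x \<noteq> 0}" using \<D>(4) by blast
  ultimately have "{x \<in> D. g x \<noteq> 0} \<in> null_sets lebesgue"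
    by (simp add: negligible_iff_null_sets)
  then have "AE x in lebesgue. x \<in> D \<longrightarrow> g x = 0"
    by (rule AE_I') auto
  then show ?thesis using Dm by (simp add: AE_restrict_space_iff)
qed

text \<open>Lebesgue measure is complete. Through this, square integrability passes to the arbitrary
  representative picked by \<open>weak_gradient\<close>.\<close>

lemma borel_measurable_lebesgue_on_AE:
  fixes f g :: "'a::euclidean_space \<Rightarrow> 'b::euclidean_space"
  assumes D: "D \<in> sets lebesgue" and f: "f \<in> borel_measurable (lebesgue_on D)"
    and ae: "AE x in lebesgue_on D. f x = g x"
  shows "g \<in> borel_measurable (lebesgue_on D)"
proof -
  have D': "D \<inter> space lebesgue \<in> sets lebesgue" using D by simp
  have "(\<lambda>x. indicator D x *\<^sub>R f x) \<in> borel_measurable lebesgue"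
    using f by (simp add: borel_measurable_restrict_space_iff[OF D'])
  moreover have "AE x in lebesgue. indicator D x *\<^sub>R f x = indicator D x *\<^sub>R g x"
    using ae D by (auto simp: AE_restrict_space_iff indicator_def elim!: eventually_mono)
  ultimately have "(\<lambda>x. indicator D x *\<^sub>R g x) \<in> borel_measurable lebesgue"
    by (rule borel_measurable_AE)
  then show ?thesis by (simp add: borel_measurable_restrict_space_iff[OF D'])
qed

section \<open>The space \<open>L2_space\<close>: null sets, inner products, Cauchy-Schwarz,
  restriction\<close>

lemma L2_space_measurable: "f \<in> L2_space S \<Longrightarrow> f \<in> borel_measurable (lebesgue_on S)"
  by (simp add: L2_space_def)

lemma L2_space_integrable: "f \<in> L2_space S \<Longrightarrow> integrable (lebesgue_on S) (\<lambda>x. (norm (f x))\<^sup>2)"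
  by (simp add: L2_space_def)

lemma L2_norm_sq: "(L2_norm S f)\<^sup>2 = (LINT x|lebesgue_on S. (norm (f x))\<^sup>2)"
  by (simp add: L2_norm_def)

lemma L2_norm_nonneg: "0 \<le> L2_norm S f"
  by (simp add: L2_norm_def)

lemma L2_norm_cong_AE:
  fixes f g :: "'a::euclidean_space \<Rightarrow> 'b::euclidean_space"
  assumes "f \<in> borel_measurable (lebesgue_on S)" "g \<in> borel_measurable (lebesgue_on S)"
    and "AE x in lebesgue_on S. f x = g x"
  shows "L2_norm S f = L2_norm S g"
proof -
  have "(LINT x|lebesgue_on S. (norm (f x))\<^sup>2) = (LINT x|lebesgue_on S. (norm (g x))\<^sup>2)"
    using assms by (intro integral_cong_AE) (auto elim: eventually_mono)
  then show ?thesis by (simp add: L2_norm_def)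
qed

lemma L2_space_cong_AE:
  fixes f g :: "'a::euclidean_space \<Rightarrow> 'b::euclidean_space"
  assumes S: "S \<in> sets lebesgue" and f: "f \<in> L2_space S" and ae: "AE x in lebesgue_on S. f x = g x"
  shows "g \<in> L2_space S"
proof -
  have g: "g \<in> borel_measurable (lebesgue_on S)"
    using borel_measurable_lebesgue_on_AE[OF S L2_space_measurable[OF f] ae] .
  moreover have "integrable (lebesgue_on S) (\<lambda>x. (norm (g x))\<^sup>2)"
    using L2_space_measurable[OF f] g ae
    by (intro integrable_cong_AE_imp[OF L2_space_integrable[OF f]]) (auto elim: eventually_mono)
  ultimately show ?thesis by (simp add: L2_space_def)
qed

lemma L2_space_inner_integrable:
  fixes f g :: "'a::euclidean_space \<Rightarrow> 'b::euclidean_space"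
  assumes f: "f \<in> L2_space S" and g: "g \<in> L2_space S"
  shows "integrable (lebesgue_on S) (\<lambda>x. f x \<bullet> g x)"
proof (rule Bochner_Integration.integrable_bound)
  show "integrable (lebesgue_on S) (\<lambda>x. (norm (f x))\<^sup>2 + (norm (g x))\<^sup>2)"
    using f g by (intro Bochner_Integration.integrable_add L2_space_integrable)
  show "(\<lambda>x. f x \<bullet> g x) \<in> borel_measurable (lebesgue_on S)"
    using f g by (intro borel_measurable_inner L2_space_measurable)
  have "\<bar>f x \<bullet> g x\<bar> \<le> (norm (f x))\<^sup>2 + (norm (g x))\<^sup>2" for x
  proof -
    have "\<bar>f x \<bullet> g x\<bar> \<le> norm (f x) * norm (g x)" by (rule Cauchy_Schwarz_ineq2)
    also have "\<dots> \<le> (norm (f x))\<^sup>2 + (norm (g x))\<^sup>2"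
      using sum_squares_bound[of "norm (f x)" "norm (g x)"] mult_nonneg_nonneg[OF norm_ge_zero norm_ge_zero, of "f x" "g x"]
      by linarith
    finally show ?thesis .
  qed
  then show "AE x in lebesgue_on S. norm (f x \<bullet> g x) \<le> norm ((norm (f x))\<^sup>2 + (norm (g x))\<^sup>2)"
    by (intro AE_I2) auto
qed

lemma norm_diff_scaleR_sq:
  fixes u v :: "'b::real_inner"
  shows "(norm (u - t *\<^sub>R v))\<^sup>2 = (norm u)\<^sup>2 - 2 * t * (u \<bullet> v) + t\<^sup>2 * (norm v)\<^sup>2"
  unfolding power2_norm_eq_inner
  by (simp add: inner_diff_left inner_diff_right inner_commute power2_eq_square algebra_simps)

text \<open>The parameter \<open>t\<close> gives differences at t = 1 and the quadratic polynomial
  behind Cauchy-Schwarz.\<close>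

lemma
  fixes f g :: "'a::euclidean_space \<Rightarrow> 'b::euclidean_space"
  assumes f: "f \<in> L2_space S" and g: "g \<in> L2_space S"
  shows L2_space_diff_scaleR: "(\<lambda>x. f x - t *\<^sub>R g x) \<in> L2_space S"
    and L2_norm_diff_scaleR_sq: "(L2_norm S (\<lambda>x. f x - t *\<^sub>R g x))\<^sup>2 =
      (L2_norm S f)\<^sup>2 - 2 * t * (LINT x|lebesgue_on S. f x \<bullet> g x) + t\<^sup>2 * (L2_norm S g)\<^sup>2"
  using L2_space_measurable[OF f] L2_space_measurable[OF g]
    L2_space_integrable[OF f] L2_space_integrable[OF g] L2_space_inner_integrable[OF f g]
  by (auto simp: L2_space_def L2_norm_sq norm_diff_scaleR_sq)

lemmas L2_space_diff = L2_space_diff_scaleR[where t = 1, simplified]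

text \<open>The squared norm of f - t g is a quadratic polynomial in t that is nonnegative
  everywhere.\<close>

lemma L2_Cauchy_Schwarz:
  fixes f g :: "'a::euclidean_space \<Rightarrow> 'b::euclidean_space"
  assumes f: "f \<in> L2_space S" and g: "g \<in> L2_space S"
  shows "\<bar>LINT x|lebesgue_on S. f x \<bullet> g x\<bar> \<le> L2_norm S f * L2_norm S g"
proof -
  define A B C where "A = (L2_norm S f)\<^sup>2" and "B = (L2_norm S g)\<^sup>2"
    and "C = (LINT x|lebesgue_on S. f x \<bullet> g x)"
  have *: "0 \<le> A - 2 * t * C + t\<^sup>2 * B" for t
    using zero_le_power2[of "L2_norm S (\<lambda>x. f x - t *\<^sub>R g x)"]
    by (simp add: L2_norm_diff_scaleR_sq[OF f g] A_def B_def C_def)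
  have "C\<^sup>2 \<le> A * B"
  proof (cases "B = 0")
    case True
    show ?thesis
    proof (cases "C = 0")
      case False
      \<comment> \<open>With \<open>B = 0\<close> the polynomial is linear and takes the value -1 at
        this point.\<close>
      then show ?thesis using *[of "(A + 1) / (2 * C)"] True by simp
    qed (simp add: A_def B_def)
  next
    case False
    then have "B > 0" by (simp add: B_def)
    \<comment> \<open>The polynomial attains its minimum at t = C / B.\<close>
    then have "A - 2 * (C / B) * C + (C / B)\<^sup>2 * B = A - C\<^sup>2 / B"
      by (simp add: field_simps power2_eq_square)
    with *[of "C / B"] have "C\<^sup>2 / B \<le> A" by simp
    with \<open>B > 0\<close> show ?thesis by (simp add: field_simps)
  qed
  then have "\<bar>C\<bar>\<^sup>2 \<le> (L2_norm S f * L2_norm S g)\<^sup>2"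
    by (simp add: A_def B_def power_mult_distrib)
  then show ?thesis
    unfolding C_def by (rule power2_le_imp_le) (simp add: L2_norm_nonneg)
qed

lemma L2_space_subset:
  fixes f :: "'a::euclidean_space \<Rightarrow> 'b::euclidean_space"
  assumes "f \<in> L2_space D" "Q \<subseteq> D" "D \<in> sets lebesgue" "Q \<in> sets lebesgue"
  shows "f \<in> L2_space Q"
proof -
  have "f \<in> borel_measurable (lebesgue_on Q)"
    using measurable_restrict_mono[OF L2_space_measurable[OF assms(1)] assms(2)] .
  moreover have "set_integrable lebesgue D (\<lambda>x. (norm (f x))\<^sup>2)"
    using L2_space_integrable[OF assms(1)] assms(3) by (simp add: integrable_restrict_space set_integrable_def)
  then have "set_integrable lebesgue Q (\<lambda>x. (norm (f x))\<^sup>2)"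
    using assms(4,2) by (rule set_integrable_subset)
  then have "integrable (lebesgue_on Q) (\<lambda>x. (norm (f x))\<^sup>2)"
    using assms(4) by (simp add: integrable_restrict_space set_integrable_def)
  ultimately show ?thesis by (simp add: L2_space_def)
qed

lemma L2_space_compact_support:
  fixes g :: "real^'d::finite \<Rightarrow> 'b::euclidean_space"
  assumes D: "D \<in> sets lebesgue" and g: "continuous_on UNIV g"
    and K: "compact K" "K \<subseteq> D" "\<And>x. x \<notin> K \<Longrightarrow> g x = 0"
  shows "g \<in> L2_space D"
proof -
  have "g \<in> borel_measurable (lebesgue_on D)"
    using continuous_imp_borel_measurable_lebesgue[OF g] by (rule measurable_restrict_space1)
  moreover have "integrable lebesgue (\<lambda>x. 1 * (norm (g x))\<^sup>2)"
    using K g by (intro integrable_mult_compact_support[OF continuous_locally_integrable_on, of _ _ K D])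
      (auto intro!: continuous_intros)
  then have "integrable (lebesgue_on D) (\<lambda>x. (norm (g x))\<^sup>2)"
    using K by (subst integral_lebesgue_on_eq(2)[OF D]) auto
  ultimately show ?thesis by (simp add: L2_space_def)
qed

section \<open>Weak gradients: differences, almost everywhere uniqueness, test functions in
  \<open>H10\<close>\<close>

lemma locally_integrable_on_diff:
  "u locally_integrable_on D \<Longrightarrow> v locally_integrable_on D \<Longrightarrow> (\<lambda>x. u x - v x) locally_integrable_on D"
  by (auto simp: locally_integrable_on_def intro!: set_integral_diff)

lemma locally_integrable_on_component:
  fixes G :: "real^'d::finite \<Rightarrow> real^'d"
  shows "G locally_integrable_on D \<Longrightarrow> (\<lambda>x. G x $ i) locally_integrable_on D"
  unfolding locally_integrable_on_def set_integrable_def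
  using integrable_bounded_linear[OF bounded_linear_vec_nth] by fastforce

lemma has_weak_gradient_diff:
  assumes D: "D \<in> sets lebesgue"
    and u: "has_weak_gradient D u G" and v: "has_weak_gradient D v H"
  shows "has_weak_gradient D (\<lambda>x. u x - v x) (\<lambda>x. G x - H x)"
  unfolding has_weak_gradient_def
proof (intro conjI ballI allI)
  have l: "u locally_integrable_on D" "v locally_integrable_on D"
    "G locally_integrable_on D" "H locally_integrable_on D"
    using u v by (auto simp: has_weak_gradient_def)
  show "(\<lambda>x. u x - v x) locally_integrable_on D" "(\<lambda>x. G x - H x) locally_integrable_on D"
    by (intro locally_integrable_on_diff l)+
  fix \<phi> :: "real^'a \<Rightarrow> real" and i assume \<phi>: "\<phi> \<in> test_functions D"
  obtain K where K: "compact K" "K \<subseteq> D" "\<And>x. x \<notin> K \<Longrightarrow> \<phi> x = 0"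
    "\<And>x. x \<notin> K \<Longrightarrow> partial_deriv i \<phi> x = 0"
    using test_functions_supportE[OF \<phi>] by metis
  have C: "C_k 1 \<phi>" using test_functions_C_k[OF \<phi>] .
  have 1: "integrable (lebesgue_on D) (\<lambda>x. w x * partial_deriv i \<phi> x)" if "w locally_integrable_on D" for w
    using K integrable_mult_compact_support[OF that C_k_1_partial_deriv_continuous[OF C] K(1,2,4)]
    by (subst integral_lebesgue_on_eq(2)[OF D]) auto
  have 2: "integrable (lebesgue_on D) (\<lambda>x. W x $ i * \<phi> x)" if "W locally_integrable_on D" for W
    using K integrable_mult_compact_support[OF locally_integrable_on_component[OF that]
        C_k_continuous_on[OF C] K(1,2,3)]
    by (subst integral_lebesgue_on_eq(2)[OF D]) auto
  show "(LINT x|lebesgue_on D. (u x - v x) * partial_deriv i \<phi> x) =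
      - (LINT x|lebesgue_on D. (G x - H x) $ i * \<phi> x)"
    using u v \<phi> by (simp add: has_weak_gradient_def left_diff_distrib
        Bochner_Integration.integral_diff 1 2 l)
qed

text \<open>The difference of the two is a weak gradient of 0, so each of its components integrates
  to zero against every test function.\<close>

lemma has_weak_gradient_unique:
  assumes D: "open D" and u: "has_weak_gradient D u G" "has_weak_gradient D u H"
  shows "AE x in lebesgue_on D. G x = H x"
proof -
  have "D \<in> sets lebesgue" using D by auto
  then have 0: "has_weak_gradient D (\<lambda>x. 0) (\<lambda>x. G x - H x)"
    using has_weak_gradient_diff[OF _ u] by simp
  have "AE x in lebesgue_on D. (G x - H x) $ i = 0" for i
  proof (rule fundamental_lemma_calculus_of_variations[OF D])
    show "(\<lambda>x. (G x - H x) $ i) locally_integrable_on D"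
      using 0 by (intro locally_integrable_on_component) (simp add: has_weak_gradient_def)
    show "(LINT x|lebesgue_on D. (G x - H x) $ i * \<phi> x) = 0" if "\<phi> \<in> test_functions D" for \<phi>
      using 0 that by (simp add: has_weak_gradient_def)
  qed
  then have "AE x in lebesgue_on D. \<forall>i. (G x - H x) $ i = 0"
    by (simp add: AE_all_countable)
  then show ?thesis by (auto simp: vec_eq_iff elim: eventually_mono)
qed

lemma has_weak_gradient_weak_gradient:
  "has_weak_gradient D u G \<Longrightarrow> has_weak_gradient D u (weak_gradient D u)"
  unfolding weak_gradient_def by (rule someI[of "has_weak_gradient D u"])

lemma weak_gradient_AE_eq:
  assumes "open D" "has_weak_gradient D u G"
  shows "AE x in lebesgue_on D. weak_gradient D u x = G x"
  using has_weak_gradient_unique[OF assms(1) has_weak_gradient_weak_gradient[OF assms(2)] assms(2)] .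

lemma weak_gradient_in_L2_space:
  assumes D: "open D" and G: "has_weak_gradient D u G" "G \<in> L2_space D"
  shows "weak_gradient D u \<in> L2_space D"
proof (rule L2_space_cong_AE[OF _ G(2)])
  show "AE x in lebesgue_on D. G x = weak_gradient D u x"
    using weak_gradient_AE_eq[OF D G(1)] by (auto elim: eventually_mono)
qed (use D in auto)

lemma L2_norm_weak_gradient:
  assumes D: "open D" and G: "has_weak_gradient D u G" "G \<in> L2_space D"
  shows "L2_norm D (weak_gradient D u) = L2_norm D G"
  using weak_gradient_AE_eq[OF D G(1)] weak_gradient_in_L2_space[OF assms] G(2)
  by (intro L2_norm_cong_AE L2_space_measurable)

text \<open>Membership in \<open>H1\<close> provides some square integrable weak gradient, while
  \<open>weak_gradient\<close> may choose another; uniqueness up to null sets bridges the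
  gap.\<close>

lemma H1_weak_gradient:
  assumes D: "open D" and u: "u \<in> H1 D"
  shows "has_weak_gradient D u (weak_gradient D u)" "weak_gradient D u \<in> L2_space D"
  using u weak_gradient_in_L2_space[OF D] has_weak_gradient_weak_gradient
  unfolding H1_def by blast+

lemma gradient_test_function_in_L2_space:
  assumes D: "D \<in> sets lebesgue" and \<phi>: "\<phi> \<in> test_functions D"
  shows "gradient \<phi> \<in> L2_space D"
proof -
  obtain K where K: "compact K" "K \<subseteq> D" "\<And>x i. x \<notin> K \<Longrightarrow> partial_deriv i \<phi> x = 0"
    using test_functions_supportE[OF \<phi>] by metis
  show ?thesis
    by (rule L2_space_compact_support[OF D _ K(1,2)])
      (auto intro!: continuous_on_vec_lambda C_k_1_partial_deriv_continuous test_functions_C_k[OF \<phi>]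
        simp: K(3) vec_eq_iff)
qed

lemma test_function_in_L2_space:
  assumes D: "D \<in> sets lebesgue" and \<phi>: "\<phi> \<in> test_functions D"
  shows "\<phi> \<in> L2_space D"
proof -
  obtain K where K: "compact K" "K \<subseteq> D" "\<And>x. x \<notin> K \<Longrightarrow> \<phi> x = 0"
    using test_functions_supportE[OF \<phi>] by metis
  show ?thesis
    using L2_space_compact_support[OF D C_k_continuous_on[OF test_functions_C_k[OF \<phi>]] K] .
qed

text \<open>A test function approximates itself, with difference the zero function. Its chosen weak
  gradient is known to vanish only almost everywhere, hence the detour through
  \<open>L2_norm_weak_gradient\<close>.\<close>

lemma test_functions_subset_H10:
  assumes D: "open D" and \<phi>: "\<phi> \<in> test_functions D"
  shows "\<phi> \<in> H10 D"
proof -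
  have Dm: "D \<in> sets lebesgue" using D by auto
  have "\<phi> \<in> L2_space D" "gradient \<phi> \<in> L2_space D"
    using test_function_in_L2_space gradient_test_function_in_L2_space Dm \<phi> by blast+
  then have "\<phi> \<in> H1 D"
    using has_weak_gradient_C_k[OF Dm test_functions_C_k[OF \<phi>]] by (auto simp: H1_def)
  have 0: "(\<lambda>x. 0 :: real^'a) \<in> L2_space D"
    by (simp add: L2_space_def)
  have "has_weak_gradient D (\<lambda>x. 0) (\<lambda>x. 0 :: real^'a)"
    using has_weak_gradient_C_k[OF Dm C_k_const[of 1 0]] by (simp add: partial_deriv_const zero_vec_def)
  then have "L2_norm D (weak_gradient D (\<lambda>x. 0)) = L2_norm D (\<lambda>x. 0 :: real^'a)"
    using D 0 by (intro L2_norm_weak_gradient)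
  then have "H1_norm D (\<lambda>x. \<phi> x - \<phi> x) = 0"
    by (simp add: H1_norm_def L2_norm_def)
  then have "\<exists>\<psi>\<in>test_functions D. H1_norm D (\<lambda>x. \<phi> x - \<psi> x) < \<epsilon>" if "\<epsilon> > 0" for \<epsilon>
    using \<phi> that by (intro bexI[of _ \<phi>]) simp_all
  with \<open>\<phi> \<in> H1 D\<close> show ?thesis
    by (simp add: H10_def)
qed

section \<open>Bump functions on the grid cubes\<close>

lemma unit_cube_eq_box: "unit_cube = box 0 (\<chi> i. 1)"
  by (auto simp: unit_cube_def mem_box_cart)

lemma open_unit_cube: "open unit_cube"
  by (simp add: unit_cube_eq_box open_box)

lemma unit_cube_lmeasurable: "unit_cube \<in> lmeasurable"
  by (simp add: unit_cube_eq_box)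

lemma unit_cube_sets_lebesgue: "unit_cube \<in> sets lebesgue"
  using unit_cube_lmeasurable by blast

lemma grid_cube_subset: "grid_cube n k \<subseteq> unit_cube"
  by (auto simp: grid_cube_def)

lemma grid_cube_sets_lebesgue: "grid_cube n (k :: 'd::finite \<Rightarrow> nat) \<in> sets lebesgue"
proof -
  have "closed {x :: real^'d. \<forall>i. real (k i) / real n \<le> x $ i}"
    by (intro closed_Collect_all closed_Collect_le continuous_intros)
  moreover have "open (\<Inter>i. {x :: real^'d. x $ i < (real (k i) + 1) / real n})"
    by (intro open_INT finite ballI open_Collect_less continuous_intros)
  moreover have "grid_cube n k = unit_cube \<inter> {x. \<forall>i. real (k i) / real n \<le> x $ i} \<inter>
      (\<Inter>i. {x. x $ i < (real (k i) + 1) / real n})"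
    by (auto simp: grid_cube_def)
  ultimately show ?thesis
    by (auto simp: unit_cube_sets_lebesgue intro!: sets.Int)
qed

lemma grid_sets_lebesgue: "Q \<in> grid n \<Longrightarrow> Q \<in> sets lebesgue"
  by (auto simp: grid_def grid_cube_sets_lebesgue)

lemma grid_subset: "Q \<in> grid n \<Longrightarrow> Q \<subseteq> unit_cube"
  using grid_cube_subset by (auto simp: grid_def)

lemma finite_grid: "finite (grid n :: (real^'d::finite) set set)"
proof -
  have "{k :: 'd \<Rightarrow> nat. \<forall>i. k i < n} = (\<Pi>\<^sub>E i\<in>UNIV. {..<n})" by auto
  then show ?thesis by (simp add: grid_def finite_PiE)
qed

text \<open>The half-open inequalities force \<open>k i\<close> to be the integer part of n
  x_i.\<close>

lemma grid_cube_index_unique: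
  assumes "x \<in> grid_cube n k" "x \<in> grid_cube n k'" "n \<ge> 1"
  shows "k = k'"
proof (rule ext)
  fix i
  have "real (k i) \<le> real n * x $ i" "real n * x $ i < real (k i) + 1"
    "real (k' i) \<le> real n * x $ i" "real n * x $ i < real (k' i) + 1"
    using assms by (auto simp: grid_cube_def field_simps)
  then show "k i = k' i" by linarith
qed

lemma grid_disjoint:
  assumes "Q \<in> grid n" "Q' \<in> grid n" "x \<in> Q" "x \<in> Q'" "n \<ge> 1"
  shows "Q = Q'"
  using assms grid_cube_index_unique unfolding grid_def by blast

lemma Union_grid:
  assumes "n \<ge> 1"
  shows "\<Union>(grid n) = unit_cube"
proof
  show "\<Union>(grid n) \<subseteq> unit_cube" using grid_subset by blast
  show "unit_cube \<subseteq> \<Union>(grid n :: (real^'d::finite) set set)"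
  proof
    fix x :: "real^'d" assume x: "x \<in> unit_cube"
    define k where "k i = nat \<lfloor>real n * x $ i\<rfloor>" for i
    have n: "real n > 0" using assms by simp
    have xi: "0 < x $ i" "x $ i < 1" for i using x by (auto simp: unit_cube_def)
    have k: "real (k i) = real_of_int \<lfloor>real n * x $ i\<rfloor>" for i
      using xi(1)[of i] n by (simp add: k_def)
    have "real (k i) \<le> real n * x $ i" "real n * x $ i < real (k i) + 1" for i
      unfolding k by linarith+
    then have "x \<in> grid_cube n k"
      using x n by (auto simp: grid_cube_def field_simps)
    moreover have "k i < n" for i
    proof -
      have "real (k i) \<le> real n * x $ i" unfolding k by linarith
      also have "\<dots> < real n" using xi(2)[of i] n by simp
      finally show ?thesis by simp
    qed
    ultimately show "x \<in> \<Union>(grid n)" by (auto simp: grid_def)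
  qed
qed

lemma measure_lebesgue_cbox_cart:
  fixes l r :: "real^'d::finite"
  assumes "\<And>i. l $ i \<le> r $ i"
  shows "measure lebesgue (cbox l r) = (\<Prod>i\<in>UNIV. r $ i - l $ i)"
proof -
  have "cbox l r \<noteq> {}" using assms by (simp add: interval_ne_empty_cart)
  then show ?thesis by (simp add: content_cbox_cart)
qed

text \<open>Enclosing \<open>Q\<close> in its closed cube gives an upper bound at once, without
  treating the missing faces of \<open>Q\<close>; the upper bound serves both norm
  estimates.\<close>

lemma measure_grid_le:
  fixes Q :: "(real^'d::finite) set"
  assumes "Q \<in> grid n" "n \<ge> 1"
  shows "measure lebesgue Q \<le> (1 / real n) ^ CARD('d)"
proof -
  obtain k where Q: "Q = grid_cube n k" using assms(1) by (auto simp: grid_def)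
  define l r :: "real^'d" where "l = (\<chi> i. real (k i) / real n)" and "r = (\<chi> i. (real (k i) + 1) / real n)"
  have lr: "l $ i \<le> r $ i" "r $ i - l $ i = 1 / real n" for i
    using assms by (auto simp: l_def r_def field_simps)
  have "Q \<subseteq> cbox l r"
    unfolding Q by (auto simp: grid_cube_def mem_box_cart l_def r_def less_imp_le)
  then have "measure lebesgue Q \<le> measure lebesgue (cbox l r)"
    using assms by (intro measure_mono_fmeasurable grid_sets_lebesgue) auto
  also have "\<dots> = (\<Prod>i\<in>UNIV. r $ i - l $ i)"
    using lr(1) by (rule measure_lebesgue_cbox_cart)
  also have "\<dots> = (1 / real n) ^ CARD('d)" by (simp add: lr(2))
  finally show ?thesis .
qed

lemma piecewise_const_eq:
  assumes "Q \<in> grid n" "x \<in> Q" "n \<ge> 1"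
  shows "piecewise_const n \<alpha> x = \<alpha> Q"
proof -
  have "\<alpha> Q' * indicator Q' x = (if Q' = Q then \<alpha> Q else 0)" if "Q' \<in> grid n" for Q'
  proof (cases "Q' = Q")
    case False
    then have "x \<notin> Q'" using grid_disjoint[OF assms(1) that assms(2) _ assms(3)] by blast
    with False show ?thesis by simp
  qed (use assms(2) in simp)
  then have "piecewise_const n \<alpha> x = (\<Sum>Q'\<in>grid n. if Q' = Q then \<alpha> Q else 0)"
    unfolding piecewise_const_def by (intro sum.cong refl)
  then show ?thesis using assms(1) by (simp add: finite_grid)
qed

lemma piecewise_const_measurable:
  "piecewise_const n \<alpha> \<in> borel_measurable (lebesgue_on S)"
  unfolding piecewise_const_def[abs_def]
  by (intro measurable_restrict_space1 borel_measurable_sum borel_measurable_times borel_measurable_const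
      borel_measurable_indicator grid_sets_lebesgue)

text \<open>The inset \<open>t\<close> is measured in units of the side length. The value 1/4 gives
  the set outside which the bump vanishes, 3/8 the set where it is bounded below, and 1/2 the centre
  point.\<close>

definition subcube :: "real \<Rightarrow> nat \<Rightarrow> ('d::finite \<Rightarrow> nat) \<Rightarrow> (real^'d) set" where
  "subcube t n k = cbox (\<chi> i. (real (k i) + t) / real n) (\<chi> i. (real (k i) + (1 - t)) / real n)"

lemma mem_subcube:
  "n \<ge> 1 \<Longrightarrow> x \<in> subcube t n k \<longleftrightarrow> (\<forall>i. real (k i) + t \<le> real n * x $ i \<and> real n * x $ i \<le> real (k i) + (1 - t))"
  by (auto simp: subcube_def mem_box_cart field_simps)

text \<open>A positive inset avoids all faces: the upper ones are excluded by half-openness, and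
  those on the boundary of the unit cube by the intersection with it.\<close>

lemma subcube_subset_grid_cube:
  assumes "\<forall>i. k i < n" "0 < t" "n \<ge> 1"
  shows "subcube t n k \<subseteq> grid_cube n k"
proof
  fix x assume "x \<in> subcube t n k"
  then have *: "real (k i) + t \<le> real n * x $ i" "real n * x $ i \<le> real (k i) + (1 - t)" for i
    using assms by (auto simp: mem_subcube)
  have "real (k i) + 1 \<le> real n" for i using assms(1) by (metis Suc_leI of_nat_Suc of_nat_le_iff add.commute)
  then have **: "0 < real n * x $ i" "real n * x $ i < real n * 1" for i
    using *[of i] assms(2) by (smt (verit) of_nat_0_le_iff)+
  have "0 < x $ i" "x $ i < 1" for i
    using **[of i] assms(3) by (simp_all add: zero_less_mult_iff mult_less_cancel_left)
  moreover have "real (k i) / real n \<le> x $ i" "x $ i < (real (k i) + 1) / real n" for i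
    using *[of i] assms(2,3) by (simp_all add: field_simps)
  ultimately show "x \<in> grid_cube n k"
    by (auto simp: grid_cube_def unit_cube_def)
qed

lemma measure_subcube:
  fixes k :: "'d::finite \<Rightarrow> nat"
  assumes "t \<le> 1 / 2" "n \<ge> 1"
  shows "measure lebesgue (subcube t n k) = ((1 - 2 * t) / real n) ^ CARD('d)"
proof -
  define l r :: "real^'d" where "l = (\<chi> i. (real (k i) + t) / real n)"
    and "r = (\<chi> i. (real (k i) + (1 - t)) / real n)"
  have lr: "l $ i \<le> r $ i" "r $ i - l $ i = (1 - 2 * t) / real n" for i
    using assms by (auto simp: l_def r_def field_simps)
  have "measure lebesgue (cbox l r) = (\<Prod>i\<in>UNIV. r $ i - l $ i)"
    using lr(1) by (rule measure_lebesgue_cbox_cart)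
  then show ?thesis by (simp add: lr(2) subcube_def flip: l_def r_def)
qed

text \<open>Steepness n compensates the side length 1/n, so the height of the bump is the same on
  every grid.\<close>

definition grid_bump :: "nat \<Rightarrow> ('d::finite \<Rightarrow> nat) \<Rightarrow> real^'d \<Rightarrow> real" where
  "grid_bump n k = bump (real n) (\<chi> i. (real (k i) + 1 / 4) / real n) (\<chi> i. (real (k i) + (1 - 1 / 4)) / real n)"

lemma grid_bump_C_k: "C_k m (grid_bump n k)"
  by (simp add: grid_bump_def C_k_bump)

lemma grid_bump_eq_0:
  assumes "n \<ge> 1" "x \<notin> subcube (1 / 4) n k"
  shows "grid_bump n k x = 0"
  using assms bump_nonzero_iff[of "real n"] box_subset_cbox unfolding grid_bump_def subcube_def
  by fastforce

lemma partial_deriv_grid_bump_eq_0: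
  assumes "n \<ge> 1" "x \<notin> subcube (1 / 4) n k"
  shows "partial_deriv i (grid_bump n k) x = 0"
  by (rule partial_deriv_eq_0_outside[OF _ grid_bump_eq_0[OF assms(1)] assms(2)])
    (auto simp: subcube_def)

lemma grid_bump_in_test_functions:
  assumes "\<forall>i. k i < n" "n \<ge> 1"
  shows "grid_bump n k \<in> test_functions unit_cube"
  using subcube_subset_grid_cube[OF assms(1) _ assms(2), of "1 / 4"] grid_cube_subset[of n k] assms
  unfolding grid_bump_def subcube_def
  by (intro bump_in_test_functions) auto

lemma flat_1_mono: "s \<le> t \<Longrightarrow> flat 1 s \<le> flat 1 t"
  by (auto simp: flat_def field_simps)

text \<open>Passing from inset 1/4 to 3/8 leaves a rescaled distance of at least 1/8 to each face of
  the supporting cube, and there are two faces per coordinate. The bound does not involve n.\<close>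

lemma grid_bump_ge:
  assumes "n \<ge> 1" "x \<in> subcube (3 / 8) n (k :: 'd::finite \<Rightarrow> nat)"
  shows "grid_bump n k x \<ge> flat 1 (1 / 8) ^ (2 * CARD('d))"
proof -
  have x: "real (k i) + 3 / 8 \<le> real n * x $ i" "real n * x $ i \<le> real (k i) + (1 - 3 / 8)" for i
    using assms by (auto simp: mem_subcube)
  have "flat 1 (1 / 8) ^ (2 * CARD('d)) = (\<Prod>i\<in>(UNIV::'d set). flat 1 (1 / 8) * flat 1 (1 / 8))"
    by (simp add: power_mult power2_eq_square)
  also have "\<dots> \<le> grid_bump n k x"
    unfolding grid_bump_def bump_def
  proof (intro prod_mono conjI mult_mono mult_nonneg_nonneg flat_1_bounds flat_1_mono)
    fix i
    show "1 / 8 \<le> real n * (x $ i - (\<chi> i. (real (k i) + 1 / 4) / real n) $ i)"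
      "1 / 8 \<le> real n * ((\<chi> i. (real (k i) + (1 - 1 / 4)) / real n) $ i - x $ i)"
      using x[of i] assms(1) by (simp_all add: right_diff_distrib)
  qed
  finally show ?thesis .
qed

text \<open>The map y = n x - k carries the cube with index k to the reference cube, which is why
  the constants below depend on the dimension alone.\<close>

lemma grid_bump_scaling:
  assumes "n \<ge> 1"
  shows "grid_bump n k x = grid_bump 1 (\<lambda>i. 0) (real n *\<^sub>R x - (\<chi> i. real (k i)))"
proof -
  have "real n * (x $ i - (real (k i) + 1 / 4) / real n) = real n * x $ i - real (k i) - 1 / 4"
    "real n * ((real (k i) + (1 - 1 / 4)) / real n - x $ i) = (1 - 1 / 4) - (real n * x $ i - real (k i))" for i
    using assms by (simp_all add: field_simps)
  then show ?thesis by (simp add: grid_bump_def bump_def)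
qed

lemma partial_deriv_scaling:
  fixes g :: "real^'d::finite \<Rightarrow> real"
  assumes "g differentiable (at (s *\<^sub>R x - c))"
  shows "partial_deriv i (\<lambda>x. g (s *\<^sub>R x - c)) x = s * partial_deriv i g (s *\<^sub>R x - c)"
proof -
  have "((\<lambda>x. g (s *\<^sub>R x - c)) has_derivative
      (\<lambda>h. frechet_derivative g (at (s *\<^sub>R x - c)) (s *\<^sub>R h))) (at x)"
    by (rule has_derivative_compose[where f = "\<lambda>x. s *\<^sub>R x - c", OF _ has_derivative_frechet[OF assms]])
      (auto intro!: derivative_eq_intros)
  then show ?thesis
    using linear_frechet_derivative[OF assms]
    by (subst partial_derivI) (assumption, simp add: linear_cmul partial_deriv_def)
qed

text \<open>The chain rule contributes the factor n; the rest is a bound for the partial derivatives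
  of the single reference bump, continuous with compact support.\<close>

lemma grid_bump_gradient_bound:
  obtains B where "B > 0"
    "\<And>n k i (x :: real^'d::finite). n \<ge> 1 \<Longrightarrow> \<bar>partial_deriv i (grid_bump n k) x\<bar> \<le> real n * B"
proof -
  let ?\<Phi> = "grid_bump 1 (\<lambda>i :: 'd. 0)"
  have C: "C_k 1 ?\<Phi>" by (rule grid_bump_C_k)
  have "\<exists>B>0. \<forall>x. \<bar>partial_deriv i ?\<Phi> x\<bar> \<le> B" for i
  proof -
    obtain B where "\<And>x. \<bar>partial_deriv i ?\<Phi> x\<bar> \<le> B" "B > 0"
    proof (rule continuous_compact_support_bounded)
      show "continuous_on UNIV (partial_deriv i ?\<Phi>)" using C_k_1_partial_deriv_continuous[OF C] .
      show "compact (subcube (1 / 4) 1 (\<lambda>i :: 'd. 0))" by (simp add: subcube_def)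
      show "partial_deriv i ?\<Phi> x = 0" if "x \<notin> subcube (1 / 4) 1 (\<lambda>i. 0)" for x
        using that by (intro partial_deriv_grid_bump_eq_0) auto
    qed blast
    then show ?thesis by blast
  qed
  then obtain b where b: "\<And>i. b i > 0" "\<And>i x. \<bar>partial_deriv i ?\<Phi> x\<bar> \<le> b i" by metis
  show thesis
  proof
    show "(\<Sum>i\<in>UNIV. b i) > 0" using b(1) by (intro sum_pos) auto
    fix n k i and x :: "real^'d" assume n: "n \<ge> (1::nat)"
    have "grid_bump n k = (\<lambda>x. ?\<Phi> (real n *\<^sub>R x - (\<chi> i. real (k i))))"
      by (rule ext) (rule grid_bump_scaling[OF n])
    then have "\<bar>partial_deriv i (grid_bump n k) x\<bar> =
        real n * \<bar>partial_deriv i ?\<Phi> (real n *\<^sub>R x - (\<chi> i. real (k i)))\<bar>"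
      by (simp only: partial_deriv_scaling[OF C_k_1_differentiable[OF C]] abs_mult abs_of_nat)
    also have "\<dots> \<le> real n * b i" using b(2) by (intro mult_left_mono) auto
    also have "\<dots> \<le> real n * (\<Sum>i\<in>UNIV. b i)"
      using b(1) by (intro mult_left_mono member_le_sum) (auto simp: less_imp_le)
    finally show "\<bar>partial_deriv i (grid_bump n k) x\<bar> \<le> real n * (\<Sum>i\<in>UNIV. b i)" .
  qed
qed

section \<open>The estimate on a single cube\<close>

lemma weak_solution_H1: "weak_solution D f a u \<Longrightarrow> u \<in> H1 D"
  by (simp add: weak_solution_def H10_def)

text \<open>The gradient of \<phi> lives on \<open>Q\<close>, where \<open>a\<close> is the constant
  \<alpha>. The test function enters the weak form through \<open>weak_gradient\<close>, which is
  replaced by the classical gradient off a null set.\<close>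

lemma weak_solution_local:
  assumes D: "open D" and u: "weak_solution D f a u" and \<phi>: "\<phi> \<in> test_functions D"
    and Q: "Q \<in> sets lebesgue" "Q \<subseteq> D"
    and a: "a \<in> borel_measurable (lebesgue_on D)" "\<And>x. x \<in> Q \<Longrightarrow> a x = \<alpha>"
    and supp: "\<And>x i. x \<notin> Q \<Longrightarrow> partial_deriv i \<phi> x = 0"
  shows "\<alpha> * (LINT x|lebesgue_on Q. weak_gradient D u x \<bullet> gradient \<phi> x) =
    (LINT x|lebesgue_on D. f x * \<phi> x)"
proof -
  have Dm: "D \<in> sets lebesgue" using D by auto
  have w\<phi>: "has_weak_gradient D \<phi> (gradient \<phi>)"
    by (rule has_weak_gradient_C_k[OF Dm test_functions_C_k[OF \<phi>]])
  have g: "gradient \<phi> \<in> borel_measurable (lebesgue_on D)"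
    by (intro L2_space_measurable gradient_test_function_in_L2_space Dm \<phi>)
  have wg: "weak_gradient D \<phi> \<in> borel_measurable (lebesgue_on D)"
    by (intro L2_space_measurable weak_gradient_in_L2_space[OF D w\<phi>]
        gradient_test_function_in_L2_space Dm \<phi>)
  have wu: "weak_gradient D u \<in> borel_measurable (lebesgue_on D)"
    by (intro L2_space_measurable H1_weak_gradient(2)[OF D] weak_solution_H1[OF u])
  have g0: "gradient \<phi> x = 0" if "x \<notin> Q" for x
    using supp[OF that] by (simp add: vec_eq_iff)
  have "(LINT x|lebesgue_on D. f x * \<phi> x) =
      (LINT x|lebesgue_on D. a x * (weak_gradient D u x \<bullet> weak_gradient D \<phi> x))"
    using u test_functions_subset_H10[OF D \<phi>] by (simp add: weak_solution_def)
  also have "\<dots> = (LINT x|lebesgue_on D. a x * (weak_gradient D u x \<bullet> gradient \<phi> x))"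
    using weak_gradient_AE_eq[OF D w\<phi>]
    by (intro integral_cong_AE borel_measurable_times borel_measurable_inner a(1) g wg wu)
      (auto elim: eventually_mono)
  also have "\<dots> = (LINT x|lebesgue_on D. \<alpha> * (weak_gradient D u x \<bullet> gradient \<phi> x))"
    by (intro Bochner_Integration.integral_cong refl) (use a(2) g0 in force)
  also have "\<dots> = \<alpha> * (LINT x|lebesgue_on D. weak_gradient D u x \<bullet> gradient \<phi> x)"
    by simp
  also have "(LINT x|lebesgue_on D. weak_gradient D u x \<bullet> gradient \<phi> x) =
      (LINT x|lebesgue_on Q. weak_gradient D u x \<bullet> gradient \<phi> x)"
  proof -
    have "weak_gradient D u x \<bullet> gradient \<phi> x = 0" if "x \<notin> Q" for x
      using g0[OF that] by simp
    then show ?thesis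
      using Q Dm by (subst (1 2) integral_lebesgue_on_eq) auto
  qed
  finally show ?thesis by simp
qed

lemma coefficient_difference_bound:
  assumes D: "open D" and ua: "weak_solution D f a u" and ub: "weak_solution D f b v"
    and \<phi>: "\<phi> \<in> test_functions D" and Q: "Q \<in> sets lebesgue" "Q \<subseteq> D"
    and a: "a \<in> borel_measurable (lebesgue_on D)" "\<And>x. x \<in> Q \<Longrightarrow> a x = \<alpha>"
    and b: "b \<in> borel_measurable (lebesgue_on D)" "\<And>x. x \<in> Q \<Longrightarrow> b x = \<beta>"
    and supp: "\<And>x i. x \<notin> Q \<Longrightarrow> partial_deriv i \<phi> x = 0"
    and \<alpha>: "0 < \<alpha>" "\<alpha> \<le> \<Lambda>" and \<beta>: "0 < \<beta>" "\<beta> \<le> \<Lambda>"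
    and F: "0 \<le> (LINT x|lebesgue_on D. f x * \<phi> x)"
  shows "(LINT x|lebesgue_on D. f x * \<phi> x) * \<bar>\<alpha> - \<beta>\<bar> \<le>
    \<Lambda>\<^sup>2 * (L2_norm Q (\<lambda>x. weak_gradient D u x - weak_gradient D v x) * L2_norm Q (gradient \<phi>))"
proof -
  have Dm: "D \<in> sets lebesgue" using D by auto
  define F where "F = (LINT x|lebesgue_on D. f x * \<phi> x)"
  define X where "X = (LINT x|lebesgue_on Q. weak_gradient D u x \<bullet> gradient \<phi> x)"
  define Y where "Y = (LINT x|lebesgue_on Q. weak_gradient D v x \<bullet> gradient \<phi> x)"
  have X: "\<alpha> * X = F" and Y: "\<beta> * Y = F"
    unfolding X_def Y_def F_def
    using weak_solution_local[OF D ua \<phi> Q a supp] weak_solution_local[OF D ub \<phi> Q b supp] by auto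
  have u: "weak_gradient D u \<in> L2_space Q" and v: "weak_gradient D v \<in> L2_space Q"
    using H1_weak_gradient(2)[OF D weak_solution_H1[OF ua]] H1_weak_gradient(2)[OF D weak_solution_H1[OF ub]] Q Dm
    by (auto intro: L2_space_subset)
  have g: "gradient \<phi> \<in> L2_space Q"
    using gradient_test_function_in_L2_space[OF Dm \<phi>] Q Dm by (auto intro: L2_space_subset)
  have "X - Y = (LINT x|lebesgue_on Q. (weak_gradient D u x - weak_gradient D v x) \<bullet> gradient \<phi> x)"
    unfolding X_def Y_def inner_diff_left
    by (intro Bochner_Integration.integral_diff[symmetric] L2_space_inner_integrable u v g)
  then have XY: "\<bar>X - Y\<bar> \<le> L2_norm Q (\<lambda>x. weak_gradient D u x - weak_gradient D v x) * L2_norm Q (gradient \<phi>)"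
    using L2_Cauchy_Schwarz[OF L2_space_diff[OF u v] g] by simp
  \<comment> \<open>Cross-multiplying the identities \<alpha> X = F and \<beta> Y = F isolates X - Y
    without a division.\<close>
  have "F * (\<beta> - \<alpha>) = \<alpha> * \<beta> * (X - Y)"
  proof -
    have "\<alpha> * \<beta> * (X - Y) = \<beta> * (\<alpha> * X) - \<alpha> * (\<beta> * Y)" by (simp add: algebra_simps)
    then show ?thesis unfolding X Y by (simp add: algebra_simps)
  qed
  then have "\<bar>F * (\<beta> - \<alpha>)\<bar> = \<bar>\<alpha> * \<beta> * (X - Y)\<bar>" by simp
  then have "F * \<bar>\<alpha> - \<beta>\<bar> = \<alpha> * \<beta> * \<bar>X - Y\<bar>"
    using F \<alpha>(1) \<beta>(1) by (simp add: abs_mult F_def abs_minus_commute)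
  also have "\<dots> \<le> \<Lambda>\<^sup>2 * \<bar>X - Y\<bar>"
    unfolding power2_eq_square using \<alpha> \<beta> by (intro mult_right_mono mult_mono) auto
  also have "\<dots> \<le> \<Lambda>\<^sup>2 * (L2_norm Q (\<lambda>x. weak_gradient D u x - weak_gradient D v x) * L2_norm Q (gradient \<phi>))"
    using XY by (intro mult_left_mono) auto
  finally show ?thesis unfolding F_def .
qed

section \<open>Estimates on the cubes and for the bump functions\<close>

lemma L2_norm_sq_le:
  fixes g :: "'a::euclidean_space \<Rightarrow> 'b::euclidean_space"
  assumes Q: "Q \<in> lmeasurable" and g: "g \<in> L2_space Q"
    and M: "\<And>x. x \<in> Q \<Longrightarrow> (norm (g x))\<^sup>2 \<le> M"
  shows "(L2_norm Q g)\<^sup>2 \<le> M * measure lebesgue Q"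
proof -
  have "(L2_norm Q g)\<^sup>2 = (LINT x|lebesgue_on Q. (norm (g x))\<^sup>2)" by (rule L2_norm_sq)
  also have "\<dots> \<le> (LINT x|lebesgue_on Q. M)"
    using M Q by (intro integral_mono L2_space_integrable[OF g])
      (auto simp: finite_measure.integrable_const finite_measure_lebesgue_on)
  also have "\<dots> = M * measure lebesgue Q"
    using Q by (simp add: measure_restrict_space fmeasurableD)
  finally show ?thesis .
qed

text \<open>Additivity of the integral over finitely many disjoint cubes; it turns the local bounds
  into the global one.\<close>

lemma L2_norm_sq_grid:
  fixes g :: "real^'d::finite \<Rightarrow> 'b::euclidean_space"
  assumes g: "g \<in> L2_space unit_cube" and n: "n \<ge> 1"
  shows "(L2_norm unit_cube g)\<^sup>2 = (\<Sum>Q\<in>grid n. (L2_norm Q g)\<^sup>2)"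
proof -
  have eq: "(L2_norm S g)\<^sup>2 = (LINT x:S|lebesgue. (norm (g x))\<^sup>2)" if "S \<in> sets lebesgue" for S
    using that by (simp add: L2_norm_sq integral_restrict_space set_lebesgue_integral_def)
  have "(LINT x:(\<Union>Q\<in>grid n. Q)|lebesgue. (norm (g x))\<^sup>2) = (\<Sum>Q\<in>grid n. LINT x:Q|lebesgue. (norm (g x))\<^sup>2)"
  proof (rule set_integral_finite_Union)
    show "disjoint_family_on (\<lambda>Q. Q) (grid n :: (real^'d) set set)"
      using grid_disjoint n by (fastforce simp: disjoint_family_on_def)
    show "set_integrable lebesgue Q (\<lambda>x. (norm (g x))\<^sup>2)" if "Q \<in> grid n" for Q
      using L2_space_integrable[OF L2_space_subset[OF g grid_subset[OF that] unit_cube_sets_lebesgue grid_sets_lebesgue[OF that]]]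
        grid_sets_lebesgue[OF that]
      by (simp add: integrable_restrict_space set_integrable_def)
  qed (auto simp: finite_grid grid_sets_lebesgue)
  then show ?thesis
    using Union_grid[OF n, where ?'a = 'd] by (simp add: eq unit_cube_sets_lebesgue grid_sets_lebesgue)
qed

text \<open>Each of the d partial derivatives is at most n B in absolute value, and the cube has
  measure at most n^(-d).\<close>

lemma L2_norm_gradient_grid_bump:
  fixes k :: "'d::finite \<Rightarrow> nat"
  assumes B: "\<And>i (x :: real^'d). \<bar>partial_deriv i (grid_bump n k) x\<bar> \<le> real n * B"
    and k: "\<forall>i. k i < n" and n: "n \<ge> 1"
  shows "(L2_norm (grid_cube n k) (gradient (grid_bump n k)))\<^sup>2 \<le>
    real CARD('d) * (real n * B)\<^sup>2 * (1 / real n) ^ CARD('d)"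
proof -
  let ?Q = "grid_cube n k"
  have Q: "?Q \<in> grid n" using k by (auto simp: grid_def)
  have "?Q \<in> lmeasurable"
    using unit_cube_lmeasurable grid_subset[OF Q] grid_sets_lebesgue[OF Q] by (rule fmeasurableI2)
  moreover have "gradient (grid_bump n k) \<in> L2_space ?Q"
    using gradient_test_function_in_L2_space[OF unit_cube_sets_lebesgue grid_bump_in_test_functions[OF k n]]
    by (rule L2_space_subset) (use grid_subset[OF Q] grid_sets_lebesgue[OF Q] unit_cube_sets_lebesgue in auto)
  moreover have "(norm (gradient (grid_bump n k) x))\<^sup>2 \<le> real CARD('d) * (real n * B)\<^sup>2" for x :: "real^'d"
  proof -
    have "(norm (gradient (grid_bump n k) x))\<^sup>2 = (\<Sum>i\<in>UNIV. (partial_deriv i (grid_bump n k) x)\<^sup>2)"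
      by (simp add: norm_vec_def L2_set_def sum_nonneg)
    also have "\<dots> \<le> (\<Sum>i\<in>(UNIV::'d set). (real n * B)\<^sup>2)"
      using B by (intro sum_mono) (metis abs_le_square_iff abs_ge_zero abs_of_nonneg order_trans)
    finally show ?thesis by simp
  qed
  ultimately have "(L2_norm ?Q (gradient (grid_bump n k)))\<^sup>2 \<le>
      real CARD('d) * (real n * B)\<^sup>2 * measure lebesgue ?Q"
    by (intro L2_norm_sq_le) auto
  also have "\<dots> \<le> real CARD('d) * (real n * B)\<^sup>2 * (1 / real n) ^ CARD('d)"
    using measure_grid_le[OF Q n] by (intro mult_left_mono) auto
  finally show ?thesis .
qed

text \<open>Only the subcube with inset 3/8 is counted; its side is (1 - 2 * 3/8) / n = 1 / (4 n).
  Elsewhere the integrand is nonnegative almost everywhere.\<close>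

lemma integral_mult_grid_bump_ge:
  fixes k :: "'d::finite \<Rightarrow> nat"
  assumes f: "f \<in> L2_space unit_cube" "AE x in lebesgue_on unit_cube. f x \<ge> c" and c: "c > 0"
    and k: "\<forall>i. k i < n" and n: "n \<ge> 1"
  shows "c * flat 1 (1 / 8) ^ (2 * CARD('d)) * (1 / 4 / real n) ^ CARD('d) \<le>
    (LINT x|lebesgue_on unit_cube. f x * grid_bump n k x)"
proof -
  let ?\<phi> = "grid_bump n k" and ?S = "subcube (3 / 8) n k"
  let ?m = "c * flat 1 (1 / 8) ^ (2 * CARD('d))"
  have "?S \<subseteq> grid_cube n k" using k n by (intro subcube_subset_grid_cube) auto
  also have "\<dots> \<subseteq> unit_cube" by (rule grid_cube_subset)
  finally have S: "?S \<subseteq> unit_cube" .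
  have Sm: "?S \<in> lmeasurable" by (simp add: subcube_def)
  have "?m * (1 / 4 / real n) ^ CARD('d) = ?m * measure lebesgue ?S"
    using n by (subst measure_subcube) auto
  also have "\<dots> = (LINT x|lebesgue_on unit_cube. ?m * indicator ?S x)"
  proof -
    have "measure (lebesgue_on unit_cube) ?S = measure lebesgue ?S"
      using S unit_cube_sets_lebesgue by (intro measure_restrict_space) auto
    then show ?thesis using S by (simp add: Int_absorb2)
  qed
  also have "\<dots> \<le> (LINT x|lebesgue_on unit_cube. f x * ?\<phi> x)"
  proof (rule integral_mono_AE)
    have "integrable lebesgue (indicator ?S :: _ \<Rightarrow> real)"
      using Sm by (intro integrable_real_indicator) (auto simp: fmeasurable_def)
    then have "integrable lebesgue (\<lambda>x. ?m * indicator ?S x)"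
      by (intro integrable_mult_right)
    moreover have "?m * indicator ?S x = 0" if "x \<notin> unit_cube" for x
      using S that by (auto simp: indicator_def)
    ultimately show "integrable (lebesgue_on unit_cube) (\<lambda>x. ?m * indicator ?S x)"
      using integral_lebesgue_on_eq(2)[OF unit_cube_sets_lebesgue, of "\<lambda>x. ?m * indicator ?S x"] by blast
    show "integrable (lebesgue_on unit_cube) (\<lambda>x. f x * ?\<phi> x)"
      using L2_space_inner_integrable[OF f(1) test_function_in_L2_space[OF unit_cube_sets_lebesgue
            grid_bump_in_test_functions[OF k n]]] by simp
    have \<phi>: "0 \<le> ?\<phi> x" for x by (simp add: grid_bump_def bump_bounds)
    have "?m * indicator ?S x \<le> f x * ?\<phi> x" if "c \<le> f x" for x
    proof (cases "x \<in> ?S")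
      case True
      then show ?thesis
        using grid_bump_ge[OF n True] that c flat_1_bounds by (auto intro!: mult_mono)
    next
      case False
      then show ?thesis using \<phi>[of x] that c by simp
    qed
    with f(2) show "AE x in lebesgue_on unit_cube. ?m * indicator ?S x \<le> f x * ?\<phi> x"
      by (auto elim: eventually_mono)
  qed
  finally show ?thesis .
qed

lemma piecewise_const_in_L2_space:
  "piecewise_const n \<alpha> \<in> L2_space (unit_cube :: (real^'d::finite) set)"
proof -
  have "\<bar>piecewise_const n \<alpha> x\<bar> \<le> (\<Sum>Q\<in>grid n. \<bar>\<alpha> Q\<bar>)" for x :: "real^'d"
  proof -
    have "\<bar>piecewise_const n \<alpha> x\<bar> \<le> (\<Sum>Q\<in>grid n. \<bar>\<alpha> Q * indicator Q x\<bar>)"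
      unfolding piecewise_const_def by (rule sum_abs)
    also have "\<dots> \<le> (\<Sum>Q\<in>grid n. \<bar>\<alpha> Q\<bar>)"
      by (intro sum_mono) (simp add: indicator_def)
    finally show ?thesis .
  qed
  then have "integrable (lebesgue_on (unit_cube :: (real^'d) set)) (\<lambda>x. (norm (piecewise_const n \<alpha> x))\<^sup>2)"
    using borel_measurable_power[OF piecewise_const_measurable[of n \<alpha> unit_cube], of 2]
    by (intro finite_measure.integrable_const_bound[where B = "(\<Sum>Q\<in>grid n. \<bar>\<alpha> Q\<bar>)\<^sup>2"]
        finite_measure_lebesgue_on unit_cube_lmeasurable AE_I2)
      (simp_all add: abs_le_square_iff[symmetric] sum_nonneg)
  then show ?thesis
    by (simp add: L2_space_def piecewise_const_measurable)
qed

text \<open>The constant is quantified before \<open>lam\<close>, \<open>f\<close>,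
  \<open>n\<close>, the coefficients and the solutions, which expresses that it depends only on
  \<open>c_f\<close>, \<open>Lam\<close> and the dimension.\<close>

theorem theorem5p2:
  fixes c_f Lam :: real
  assumes "CARD('d::finite) \<ge> 2" and "c_f > 0"
  shows "\<exists>C>0. \<forall>(lam::real) (f :: real^'d \<Rightarrow> real) (n::nat)
            (a_coeff :: (real^'d) set \<Rightarrow> real) (b_coeff :: (real^'d) set \<Rightarrow> real)
            (a :: real^'d \<Rightarrow> real) (b :: real^'d \<Rightarrow> real)
            (u_a :: real^'d \<Rightarrow> real) (u_b :: real^'d \<Rightarrow> real).
          0 < lam \<and> lam < Lam \<and>
          f \<in> L2_space unit_cube \<and> (AE x in lebesgue_on unit_cube. f x \<ge> c_f) \<and>
          n \<ge> 1 \<and>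
          a = piecewise_const n a_coeff \<and> a \<in> diffusion_coeffs lam Lam n \<and>
          b = piecewise_const n b_coeff \<and> b \<in> diffusion_coeffs lam Lam n \<and>
          weak_solution unit_cube f a u_a \<and> weak_solution unit_cube f b u_b \<longrightarrow>
          (\<forall>Q\<in>grid n.
             \<bar>a_coeff Q - b_coeff Q\<bar> \<le>
               C * real n powr ((real CARD('d) + 2) / 2) *
               L2_norm Q (\<lambda>x. weak_gradient unit_cube u_a x - weak_gradient unit_cube u_b x)) \<and>
          L2_norm unit_cube (\<lambda>x. a x - b x) \<le>
            C * real n * H10_norm unit_cube (\<lambda>x. u_a x - u_b x)"
proof -
  let ?d = "CARD('d)"
  obtain B where B: "B > 0"
    "\<And>n k i (x :: real^'d). n \<ge> 1 \<Longrightarrow> \<bar>partial_deriv i (grid_bump n k) x\<bar> \<le> real n * B"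
    using grid_bump_gradient_bound by blast
  \<comment> \<open>The lower bound for the integral of \<open>f\<close> against a grid bump is
    \<open>C0\<close> divided by n^d.\<close>
  define C0 where "C0 = c_f * flat 1 (1 / 8) ^ (2 * ?d) * (1 / 4) ^ ?d"
  have C0: "C0 > 0"
    unfolding C0_def using assms(2) by (intro mult_pos_pos zero_less_power) (auto simp: flat_1_pos_iff)
  \<comment> \<open>\<open>Lam\<^sup>2\<close> bounds the product of the coefficients and
    \<open>sqrt ?d * B\<close> comes from the bump gradient. The added 1 makes \<open>C\<close>
    positive for every real \<open>Lam\<close>, since 0 < lam < Lam is not yet available.\<close>
  define C where "C = (Lam\<^sup>2 + 1) * sqrt ?d * B / C0"
  have C: "C > 0"
    unfolding C_def using B(1) C0 by (intro mult_pos_pos divide_pos_pos) (auto simp: add_nonneg_pos)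
  show ?thesis
  proof (intro exI[of _ C] conjI C allI impI; elim conjE)
    fix lam :: real and f a b u v :: "real^'d \<Rightarrow> real" and n :: nat and \<alpha> \<beta> :: "(real^'d) set \<Rightarrow> real"
    assume lam: "0 < lam" "lam < Lam" and n: "1 \<le> n"
      and f: "f \<in> L2_space unit_cube" "AE x in lebesgue_on unit_cube. c_f \<le> f x"
      and a: "a = piecewise_const n \<alpha>" "a \<in> diffusion_coeffs lam Lam n"
      and b: "b = piecewise_const n \<beta>" "b \<in> diffusion_coeffs lam Lam n"
      and u: "weak_solution unit_cube f a u" and v: "weak_solution unit_cube f b v"
    \<comment> \<open>Writing n^(d/2) as \<open>s\<close> keeps real exponents out of the estimates
      until the bound is stated.\<close>
    define s where "s = sqrt (real n ^ ?d)"
    have s: "s > 0" "s\<^sup>2 = real n ^ ?d" using n by (auto simp: s_def)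
    define w where "w x = weak_gradient unit_cube u x - weak_gradient unit_cube v x" for x
    \<comment> \<open>Membership in \<open>diffusion_coeffs\<close> bounds some representing family,
      not necessarily the given one. Both agree on \<open>Q\<close>, as the two functions can be
      compared at the centre of the cube.\<close>
    have coeff: "0 < \<gamma> Q \<and> \<gamma> Q \<le> Lam"
      if Q: "Q \<in> grid n" and \<gamma>: "piecewise_const n \<gamma> \<in> diffusion_coeffs lam Lam n" for \<gamma> and Q :: "(real^'d) set"
    proof -
      obtain \<delta> where \<delta>: "piecewise_const n \<gamma> = piecewise_const n \<delta>" "\<forall>Q\<in>grid n. \<delta> Q \<in> {lam..Lam}"
        using \<gamma> by (auto simp: diffusion_coeffs_def)
      obtain k where k: "Q = grid_cube n k" "\<forall>i. k i < n" using Q by (auto simp: grid_def)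
      have "(\<chi> i. (real (k i) + 1 / 2) / real n) \<in> subcube (1 / 2) n k"
        using n by (simp add: mem_subcube)
      then obtain x where "x \<in> Q"
        using subcube_subset_grid_cube[OF k(2) _ n, of "1 / 2"] k(1) by auto
      then have "\<gamma> Q = \<delta> Q"
        using piecewise_const_eq[OF Q _ n] \<delta>(1) by metis
      with \<delta>(2) Q lam show ?thesis by force
    qed
    have local_bound: "\<bar>\<alpha> Q - \<beta> Q\<bar> \<le> C * real n * s * L2_norm Q w" if Q: "Q \<in> grid n" for Q
    proof -
      obtain k where k: "Q = grid_cube n k" "\<forall>i. k i < n" using Q by (auto simp: grid_def)
      let ?\<phi> = "grid_bump n k"
      define F where "F = (LINT x|lebesgue_on unit_cube. f x * ?\<phi> x)"
      have "C0 / s\<^sup>2 = c_f * flat 1 (1 / 8) ^ (2 * ?d) * (1 / 4 / real n) ^ ?d"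
        by (simp add: C0_def s(2) power_divide power_mult_distrib)
      also have "\<dots> \<le> F"
        unfolding F_def by (rule integral_mult_grid_bump_ge[OF f assms(2) k(2) n])
      finally have F: "C0 / s\<^sup>2 \<le> F" .
      have "0 < C0 / s\<^sup>2" using C0 s(1) by simp
      with F have Fpos: "0 < F" by linarith
      have supp: "partial_deriv i ?\<phi> x = 0" if "x \<notin> Q" for x i
        using that subcube_subset_grid_cube[OF k(2) _ n, of "1 / 4"] k(1)
        by (intro partial_deriv_grid_bump_eq_0[OF n]) auto
      have "(L2_norm Q (gradient ?\<phi>))\<^sup>2 \<le> real ?d * (real n * B)\<^sup>2 * (1 / real n) ^ ?d"
        unfolding k(1) by (rule L2_norm_gradient_grid_bump[OF B(2)[OF n] k(2) n])
      also have "\<dots> = (sqrt ?d * (real n * B) / s)\<^sup>2"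
        by (simp add: power_mult_distrib power_divide s(2))
      finally have g: "L2_norm Q (gradient ?\<phi>) \<le> sqrt ?d * (real n * B) / s"
        by (rule power2_le_imp_le) (use B(1) s(1) in simp)
      have "C0 / s\<^sup>2 * \<bar>\<alpha> Q - \<beta> Q\<bar> \<le> F * \<bar>\<alpha> Q - \<beta> Q\<bar>"
        using F by (intro mult_right_mono) auto
      also have "\<dots> \<le> Lam\<^sup>2 * (L2_norm Q w * L2_norm Q (gradient ?\<phi>))"
        unfolding F_def w_def
      proof (rule coefficient_difference_bound[OF open_unit_cube u v])
        show "?\<phi> \<in> test_functions unit_cube" by (rule grid_bump_in_test_functions[OF k(2) n])
        show "0 \<le> (LINT x|lebesgue_on unit_cube. f x * ?\<phi> x)" using Fpos by (simp add: F_def)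
      qed (use Q a b coeff[OF Q] supp n in
          \<open>auto simp: grid_sets_lebesgue piecewise_const_measurable piecewise_const_eq dest: grid_subset\<close>)
      also have "\<dots> \<le> (Lam\<^sup>2 + 1) * (L2_norm Q w * (sqrt ?d * (real n * B) / s))"
        using g by (intro mult_mono mult_nonneg_nonneg L2_norm_nonneg) auto
      \<comment> \<open>Multiplying by \<open>s\<^sup>2 / C0\<close> turns the factor 1/s into
        s.\<close>
      finally show ?thesis
        using C0 s(1) by (simp add: C_def field_simps power2_eq_square)
    qed
    have powr: "real n * s = real n powr ((real ?d + 2) / 2)"
    proof -
      have "s = real n powr (real ?d / 2)"
        using n by (simp add: s_def powr_half_sqrt[symmetric] powr_realpow[symmetric] powr_powr)
      then show ?thesis
        using n by (simp add: add_divide_distrib powr_add)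
    qed
    show "\<forall>Q\<in>grid n. \<bar>\<alpha> Q - \<beta> Q\<bar> \<le> C * real n powr ((real ?d + 2) / 2) *
        L2_norm Q (\<lambda>x. weak_gradient unit_cube u x - weak_gradient unit_cube v x)"
      using local_bound by (simp add: powr[symmetric] w_def[abs_def] mult.assoc)
    have w: "has_weak_gradient unit_cube (\<lambda>x. u x - v x) w" "w \<in> L2_space unit_cube"
      unfolding w_def[abs_def]
      by (intro has_weak_gradient_diff L2_space_diff H1_weak_gradient open_unit_cube unit_cube_sets_lebesgue
          weak_solution_H1[OF u] weak_solution_H1[OF v])+
    have ab: "(\<lambda>x. a x - b x) \<in> L2_space unit_cube"
      unfolding a(1) b(1) by (intro L2_space_diff piecewise_const_in_L2_space)
    have "(L2_norm unit_cube (\<lambda>x. a x - b x))\<^sup>2 = (\<Sum>Q\<in>grid n. (L2_norm Q (\<lambda>x. a x - b x))\<^sup>2)"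
      by (rule L2_norm_sq_grid[OF ab n])
    also have "\<dots> \<le> (\<Sum>Q\<in>grid n. (C * real n)\<^sup>2 * (L2_norm Q w)\<^sup>2)"
    proof (rule sum_mono)
      fix Q :: "(real^'d) set" assume Q: "Q \<in> grid n"
      have "Q \<in> lmeasurable"
        using unit_cube_lmeasurable grid_subset[OF Q] grid_sets_lebesgue[OF Q] by (rule fmeasurableI2)
      moreover have "(\<lambda>x. a x - b x) \<in> L2_space Q"
        using ab grid_subset[OF Q] unit_cube_sets_lebesgue grid_sets_lebesgue[OF Q] by (rule L2_space_subset)
      ultimately have "(L2_norm Q (\<lambda>x. a x - b x))\<^sup>2 \<le> \<bar>\<alpha> Q - \<beta> Q\<bar>\<^sup>2 * measure lebesgue Q"
        by (rule L2_norm_sq_le) (simp add: a(1) b(1) piecewise_const_eq[OF Q _ n])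
      \<comment> \<open>The measure of the cube cancels \<open>s\<^sup>2\<close>, which lowers the
        exponent from (d+2)/2 in the local bound to 1 in the global one.\<close>
      also have "\<dots> \<le> (C * real n * s * L2_norm Q w)\<^sup>2 * (1 / s\<^sup>2)"
        using local_bound[OF Q] measure_grid_le[OF Q n]
        by (intro mult_mono power_mono) (auto simp: s(2) power_divide)
      also have "\<dots> = (C * real n)\<^sup>2 * (L2_norm Q w)\<^sup>2"
        using s(1) by (simp add: power_mult_distrib)
      finally show "(L2_norm Q (\<lambda>x. a x - b x))\<^sup>2 \<le> (C * real n)\<^sup>2 * (L2_norm Q w)\<^sup>2" .
    qed
    also have "\<dots> = (C * real n * L2_norm unit_cube w)\<^sup>2"
      by (simp add: sum_distrib_left[symmetric] L2_norm_sq_grid[OF w(2) n] power_mult_distrib)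
    \<comment> \<open>The weak gradient chosen for \<open>u - v\<close> need not be
      \<open>w\<close>, the difference of the chosen ones, but the two agree almost
      everywhere.\<close>
    also have "L2_norm unit_cube w = H10_norm unit_cube (\<lambda>x. u x - v x)"
      unfolding H10_norm_def by (rule L2_norm_weak_gradient[OF open_unit_cube w, symmetric])
    finally show "L2_norm unit_cube (\<lambda>x. a x - b x) \<le> C * real n * H10_norm unit_cube (\<lambda>x. u x - v x)"
      by (rule power2_le_imp_le) (use C in \<open>simp add: H10_norm_def L2_norm_nonneg\<close>)
  qed
qed

end
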